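(* Let $d\ge 1$, $T\ge 1$, $B\ge 1$, and let the reward noise variance be $\sigma^2$ with $\sigma=\Theta(1)$. For any specified set size $K\ge 16$ there exists an action set $\mathcal{A}$ of that size, $|\mathcal{A}|=K$, with $\max_{a\in\mathcal{A}}\|a\|_2\le 1$, such that for every algorithm operating in $M=\lceil T/B\rceil$ batches that receives only one bit of feedback per batch, the expected cumulative regret satisfies $$\sup_{\|\theta\|_2\le 1}\mathbb{E}[R_T]=\widetilde{\Omega}\Bigl(\min\Bigl\{T,\ B\min\{d,\log|\mathcal{A}|\}+\sqrt{dT\min\{d,\log|\mathcal{A}|\}}\Bigr\}\Bigr).$$ When $|\mathcal{A}|=\exp(\Omega(d))$ this simplifies to $\widetilde{\Omega}(\min\{T,\,dB+d\sqrt{T}\})$, and when $|\mathcal{A}|=\exp(O(d))$ this simplifies to $\widetilde{\Omega}(\min\{T,\,B\log|\mathcal{A}|+\sqrt{dT\log|\mathcal{A}|}\})$. Here $\widetilde{\Omega}(\cdot)$ hides possible logarithmic dependencies on $d$ in the final (square-root) term.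
   Context: Batched stochastic linear bandit with 1-bit feedback. There are a dimension $d$, a finite action set $\mathcal{A}\subset\mathbb{R}^d$, an unknown parameter $\theta\in\mathbb{R}^d$ and a time horizon $T$. The vectors in $\mathcal{A}$ are distinct and span $\mathbb{R}^d$ (so the set size is understood to be compatible with this), and mean rewards are bounded, $|\langle a,\theta\rangle|\le 1$ for all $a\in\mathcal{A}$ (automatic here, since $\|a\|_2\le 1$ and $\|\theta\|_2\le 1$). At each time $t=1,\dots,T$ an action $A_t\in\mathcal{A}$ is played and a reward $Y_t=\langle A_t,\theta\rangle+\xi_t$ is generated, where $(\xi_t)_{t=1}^T$ are i.i.d. noise terms with $\mathbb{E}[\xi_t]=0$ and $\mathbb{E}[\xi_t^2]\le\sigma^2$, with $\sigma$ known. The horizon is split into $M=\lceil T/B\rceil$ consecutive batches of size $B$ (except possibly a shorter final batch). At the beginning of batch $m$ the learner chooses the whole sequence of actions of the batch and a 1-bit quantization function $Q_m:\mathbb{R}^B\to\{0,1\}$, both of which may depend (possibly with randomization) on the feedback received from batches $1,\dots,m-1$. An agent observes the rewards of batch $m$ and transmits to the learner only the single bit $Q_m(\text{rewards of batch }m)$. The cumulative regret is $R_T=\sum_{t=1}^T\langle a^*-A_t,\theta\rangle$ with $a^*=\arg\max_{a\in\mathcal{A}}\langle a,\theta\rangle$. $\sigma=\Theta(1)$ means that $\sigma$ lies between two fixed positive constants. *)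

theory Defs
  imports "HOL-Probability.Probability" "Jordan_Normal_Form.VS_Connect"
begin

text \<open>
  Vectors of \<open>\<real>\<^sup>d\<close> are elements of \<^term>\<open>carrier_vec d :: real vec set\<close>, because \<open>d\<close> has to be
  quantified inside the scope of constants that do not depend on it.
\<close>

type_synonym rvec = "real Matrix.vec"

definition l2_norm :: "rvec \<Rightarrow> real" where
  "l2_norm v = sqrt (scalar_prod v v)"

definition spans :: "nat \<Rightarrow> rvec set \<Rightarrow> bool" where
  "spans d A \<longleftrightarrow>
     LinearCombinations.module.span class_ring (module_vec TYPE(real) d) A = carrier_vec d"

definition action_set :: "nat \<Rightarrow> rvec set \<Rightarrow> bool" where
  "action_set d A \<longleftrightarrow> finite A \<and> A \<subseteq> carrier_vec d \<and> spans d A"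

definition noise_law :: "real \<Rightarrow> real measure \<Rightarrow> bool" where
  "noise_law \<sigma> \<nu> \<longleftrightarrow> prob_space \<nu> \<and> sets \<nu> = sets borel \<and>
     integrable \<nu> (\<lambda>x. x) \<and> (\<integral>x. x \<partial>\<nu>) = 0 \<and>
     integrable \<nu> (\<lambda>x. x\<^sup>2) \<and> (\<integral>x. x\<^sup>2 \<partial>\<nu>) = \<sigma>\<^sup>2"

definition num_batches :: "nat \<Rightarrow> nat \<Rightarrow> nat" where
  "num_batches T B = nat \<lceil>real T / real B\<rceil>"

text \<open>
  Times are \<open>0, \<dots>, T - 1\<close>, batches are numbered from \<open>0\<close>, and time \<open>t\<close> lies in batch \<open>t div B\<close>.
  All randomization of a learner comes from one seed, drawn independently of the noise from an
  arbitrary Borel law on the reals; since the reals are Borel isomorphic to sequences of reals,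
  this covers fresh (and correlated) randomization in every batch.  Given the seed, the actions and
  the quantizer of a batch are functions of the list of bits received in the earlier batches.  The
  quantizer sees the rewards of its batch at positions \<open>0, \<dots>, B - 1\<close>.
\<close>

record learner =
  seed_law :: "real measure"
  play :: "real \<Rightarrow> bool list \<Rightarrow> nat \<Rightarrow> rvec"
  quantizer :: "real \<Rightarrow> bool list \<Rightarrow> (nat \<Rightarrow> real) \<Rightarrow> bool"

definition valid_learner :: "nat \<Rightarrow> nat \<Rightarrow> rvec set \<Rightarrow> learner \<Rightarrow> bool" where
  "valid_learner T B A L \<longleftrightarrow>
     prob_space (seed_law L) \<and> sets (seed_law L) = sets borel \<and>
     (\<forall>t<T. \<forall>h. length h = t div B \<longrightarrow>
        (\<lambda>u. play L u h t) \<in> measurable borel (count_space A)) \<and>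
     (\<forall>h. length h < num_batches T B \<longrightarrow>
        (\<lambda>(u, y). quantizer L u h y)
          \<in> measurable (borel \<Otimes>\<^sub>M (\<Pi>\<^sub>M j\<in>{..<B}. borel)) (count_space UNIV))"

text \<open>
  \<open>feedback L B \<theta> u \<xi> m\<close> is the list of bits of the first \<open>m\<close> batches for seed \<open>u\<close> and noise \<open>\<xi>\<close>.
  The bit of the last batch, the only one that may be shorter than \<open>B\<close>, influences no action.
\<close>

primrec feedback ::
  "learner \<Rightarrow> nat \<Rightarrow> rvec \<Rightarrow> real \<Rightarrow> (nat \<Rightarrow> real) \<Rightarrow> nat \<Rightarrow> bool list" where
  "feedback L B \<theta> u \<xi> 0 = []"
| "feedback L B \<theta> u \<xi> (Suc m) =
     (let h = feedback L B \<theta> u \<xi> m;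
          reward = (\<lambda>t. scalar_prod (play L u h t) \<theta> + \<xi> t)
      in h @ [quantizer L u h (\<lambda>j\<in>{..<B}. reward (m * B + j))])"

definition action_at ::
  "learner \<Rightarrow> nat \<Rightarrow> rvec \<Rightarrow> real \<Rightarrow> (nat \<Rightarrow> real) \<Rightarrow> nat \<Rightarrow> rvec" where
  "action_at L B \<theta> u \<xi> t = play L u (feedback L B \<theta> u \<xi> (t div B)) t"

definition best_action :: "rvec set \<Rightarrow> rvec \<Rightarrow> rvec" where
  "best_action A \<theta> = arg_max_on (\<lambda>a. scalar_prod a \<theta>) A"

definition regret ::
  "learner \<Rightarrow> nat \<Rightarrow> nat \<Rightarrow> rvec set \<Rightarrow> rvec \<Rightarrow> real \<Rightarrow> (nat \<Rightarrow> real) \<Rightarrow> real" where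
  "regret L T B A \<theta> u \<xi> =
     (\<Sum>t<T. scalar_prod (best_action A \<theta> - action_at L B \<theta> u \<xi> t) \<theta>)"

definition expected_regret ::
  "real measure \<Rightarrow> learner \<Rightarrow> nat \<Rightarrow> nat \<Rightarrow> rvec set \<Rightarrow> rvec \<Rightarrow> real" where
  "expected_regret \<nu> L T B A \<theta> =
     (\<integral>(u, \<xi>). regret L T B A \<theta> u \<xi> \<partial>(seed_law L \<Otimes>\<^sub>M (\<Pi>\<^sub>M t\<in>{..<T}. \<nu>)))"

definition worst_case_regret ::
  "real measure \<Rightarrow> learner \<Rightarrow> nat \<Rightarrow> nat \<Rightarrow> nat \<Rightarrow> rvec set \<Rightarrow> real" where
  "worst_case_regret \<nu> L d T B A =
     (SUP \<theta>\<in>{\<theta> \<in> carrier_vec d. l2_norm \<theta> \<le> 1}. expected_regret \<nu> L T B A \<theta>)"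

text \<open>
  \<open>d \<le> K\<close> is the compatibility of the set size with the requirement that the actions span \<open>\<real>\<^sup>d\<close>.
\<close>

definition admissible ::
  "real \<Rightarrow> real \<Rightarrow> nat \<Rightarrow> nat \<Rightarrow> nat \<Rightarrow> nat \<Rightarrow> real \<Rightarrow> bool" where
  "admissible \<sigma>lo \<sigma>hi d T B K \<sigma> \<longleftrightarrow>
     1 \<le> d \<and> 1 \<le> T \<and> 1 \<le> B \<and> 16 \<le> K \<and> d \<le> K \<and> \<sigma>lo \<le> \<sigma> \<and> \<sigma> \<le> \<sigma>hi"

text \<open>
  The lower bound of order \<open>min T (f + g)\<close> up to a constant factor and, in the term \<open>g\<close> only, a
  factor polylogarithmic in \<open>d\<close>, over all parameters with \<open>P d K\<close>.  Both \<open>f\<close> and \<open>g\<close> take the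
  arguments \<open>d T B K\<close>.  The base is \<open>1 + ln d\<close> because \<open>ln d\<close> vanishes at \<open>d = 1\<close>.
\<close>

definition regret_Omega_tilde ::
  "(real \<Rightarrow> real measure) \<Rightarrow> (nat \<Rightarrow> nat \<Rightarrow> nat \<Rightarrow> nat \<Rightarrow> real \<Rightarrow> rvec set) \<Rightarrow>
   real \<Rightarrow> real \<Rightarrow> (nat \<Rightarrow> nat \<Rightarrow> bool) \<Rightarrow>
   (nat \<Rightarrow> nat \<Rightarrow> nat \<Rightarrow> nat \<Rightarrow> real) \<Rightarrow> (nat \<Rightarrow> nat \<Rightarrow> nat \<Rightarrow> nat \<Rightarrow> real) \<Rightarrow> bool" where
  "regret_Omega_tilde noise hard \<sigma>lo \<sigma>hi P f g \<longleftrightarrow>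
     (\<exists>c>0. \<exists>p::nat. \<forall>d T B K \<sigma> L.
        admissible \<sigma>lo \<sigma>hi d T B K \<sigma> \<longrightarrow> P d K \<longrightarrow> valid_learner T B (hard d T B K \<sigma>) L \<longrightarrow>
        worst_case_regret (noise \<sigma>) L d T B (hard d T B K \<sigma>)
          \<ge> c * min (real T) (f d T B K + g d T B K / (1 + ln (real d)) ^ p))"

end

theory Submission
  imports Defs
begin

text \<open>
  The noise is Gaussian.  The hard actions are products over \<open>m\<close> blocks of \<open>k\<close> coordinates: an action
  selects one arm in each block, and the parameter makes one unknown arm of each block good.  The
  actions that are added to span the space and to reach the size \<open>K\<close> are small in every block, so
  they earn and reveal no more than products do.

  Term \<open>B min d (ln K)\<close>: before batch \<open>M\<close> the learner has seen \<open>M\<close> bits, so at each time it chooses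
  among \<open>2 ^ M\<close> actions that do not depend on the parameter.  Averaged over the \<open>k ^ m\<close> parameters,
  the best of these stays a constant factor below the optimum while \<open>M\<close> is at most a multiple of
  \<open>m ln k\<close>.

  Term \<open>sqrt (d T min d (ln K))\<close>: compare the good arm of a block with no good arm at all in that
  block.  By a change of measure the good arm is played hardly more often as long as the signal \<open>\<delta>\<close>
  satisfies \<open>\<delta>\<^sup>2 T \<lesssim> \<sigma>\<^sup>2 k\<close>, which gives a regret of order \<open>min T (\<sigma> sqrt (m\<^sup>2 k T))\<close>.

  The action set may depend on \<open>T\<close> and \<open>B\<close>, so \<open>m\<close> and \<open>k\<close> are chosen for the larger of the two
  terms: \<open>k = 4\<close> for the first and \<open>k = d div m\<close> for the second.  If \<open>K \<le> d\<^sup>3\<close>, one block of size \<open>d\<close>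
  serves both; if \<open>d < 4\<close>, one block with two arms, the unit vectors of opposite sign, does.
\<close>

section \<open>Gaussian noise with predictable drift\<close>

definition gaussian :: "real \<Rightarrow> real measure" where
  "gaussian \<sigma> = density lborel (\<lambda>x. ennreal (normal_density 0 \<sigma> x))"

lemma sets_gaussian [simp, measurable_cong]: "sets (gaussian \<sigma>) = sets borel"
  by (simp add: gaussian_def)

lemma space_gaussian [simp]: "space (gaussian \<sigma>) = UNIV"
  by (simp add: gaussian_def)

lemma prob_space_gaussian: "0 < \<sigma> \<Longrightarrow> prob_space (gaussian \<sigma>)"
  unfolding gaussian_def by (rule prob_space_normal_density)

lemma gaussian_moments:
  assumes "0 < \<sigma>"
  shows "integrable (gaussian \<sigma>) (\<lambda>x. x)" "(\<integral>x. x \<partial>gaussian \<sigma>) = 0"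
    "integrable (gaussian \<sigma>) (\<lambda>x. x\<^sup>2)" "(\<integral>x. x\<^sup>2 \<partial>gaussian \<sigma>) = \<sigma>\<^sup>2"
proof -
  have 1: "has_bochner_integral lborel (\<lambda>x. normal_density 0 \<sigma> x * x) 0"
    by (rule normal_moment_nz_1[OF assms])
  have 2: "has_bochner_integral lborel (\<lambda>x. normal_density 0 \<sigma> x * x\<^sup>2) (\<sigma>\<^sup>2)"
    using normal_moment_even[OF assms, of 0 1] by simp
  show "integrable (gaussian \<sigma>) (\<lambda>x. x)" "(\<integral>x. x \<partial>gaussian \<sigma>) = 0"
    using 1 by (auto simp: gaussian_def integrable_density integral_density has_bochner_integral_iff)
  show "integrable (gaussian \<sigma>) (\<lambda>x. x\<^sup>2)" "(\<integral>x. x\<^sup>2 \<partial>gaussian \<sigma>) = \<sigma>\<^sup>2"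
    using 2 by (auto simp: gaussian_def integrable_density integral_density has_bochner_integral_iff)
qed

lemma noise_law_gaussian: "0 < \<sigma> \<Longrightarrow> noise_law \<sigma> (gaussian \<sigma>)"
  by (simp add: noise_law_def prob_space_gaussian gaussian_moments)

text \<open>Completing the square: the factor is the likelihood ratio of the normal law with mean
  \<open>c\<close> to the centred one. With nonnegative integrals no integrability of the factor has
  to be known.\<close>

lemma nn_integral_gaussian_shift:
  assumes "0 < \<sigma>" and [measurable]: "f \<in> borel_measurable borel"
  shows "(\<integral>\<^sup>+x. f (x + c) \<partial>gaussian \<sigma>) =
    (\<integral>\<^sup>+x. f x * ennreal (exp ((c * x - c\<^sup>2 / 2) / \<sigma>\<^sup>2)) \<partial>gaussian \<sigma>)"
proof -
  have *: "normal_density 0 \<sigma> (x - c) = normal_density 0 \<sigma> x * exp ((c * x - c\<^sup>2 / 2) / \<sigma>\<^sup>2)" for x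
  proof -
    have "- ((x - c)\<^sup>2) / (2 * \<sigma>\<^sup>2) = - (x\<^sup>2) / (2 * \<sigma>\<^sup>2) + (c * x - c\<^sup>2 / 2) / \<sigma>\<^sup>2"
      using assms(1) by (simp add: field_simps power2_eq_square)
    then show ?thesis
      unfolding normal_density_def diff_0_right by (simp only: exp_add mult.assoc)
  qed
  have "(\<integral>\<^sup>+x. f (x + c) \<partial>gaussian \<sigma>) = (\<integral>\<^sup>+x. ennreal (normal_density 0 \<sigma> x) * f (x + c) \<partial>lborel)"
    unfolding gaussian_def by (subst nn_integral_density) auto
  also have "\<dots> = (\<integral>\<^sup>+x. ennreal (normal_density 0 \<sigma> (x - c)) * f x \<partial>lborel)"
    by (subst nn_integral_real_affine[where c = 1 and t = c]) (auto simp: add.commute)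
  also have "\<dots> = (\<integral>\<^sup>+x. ennreal (normal_density 0 \<sigma> x) *
      (f x * ennreal (exp ((c * x - c\<^sup>2 / 2) / \<sigma>\<^sup>2))) \<partial>lborel)"
    by (simp add: * ennreal_mult' ac_simps)
  also have "\<dots> = (\<integral>\<^sup>+x. f x * ennreal (exp ((c * x - c\<^sup>2 / 2) / \<sigma>\<^sup>2)) \<partial>gaussian \<sigma>)"
    unfolding gaussian_def by (subst nn_integral_density) auto
  finally show ?thesis .
qed

section \<open>Predictable drift and the change of measure in discrete time\<close>

abbreviation iid :: "real measure \<Rightarrow> nat \<Rightarrow> (nat \<Rightarrow> real) measure" where
  "iid \<nu> n \<equiv> \<Pi>\<^sub>M t\<in>{..<n}. \<nu>"

text \<open>Dependence on the past is demanded for all functions, extensional or not, so that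
  coordinates can be overwritten freely, as in \<open>predictable_upd\<close>.\<close>

definition predictable :: "(nat \<Rightarrow> (nat \<Rightarrow> real) \<Rightarrow> real) \<Rightarrow> nat \<Rightarrow> bool" where
  "predictable \<mu> n \<longleftrightarrow> (\<forall>t<n. \<mu> t \<in> borel_measurable (\<Pi>\<^sub>M s\<in>{..<n}. borel) \<and>
     (\<forall>x y. (\<forall>s<t. x s = y s) \<longrightarrow> \<mu> t x = \<mu> t y))"

text \<open>The value \<open>undefined\<close> keeps the sequence in the extensional product space.\<close>

primrec drift :: "(nat \<Rightarrow> (nat \<Rightarrow> real) \<Rightarrow> real) \<Rightarrow> (nat \<Rightarrow> real) \<Rightarrow> nat \<Rightarrow> nat \<Rightarrow> real" where
  "drift \<mu> x 0 = (\<lambda>_. undefined)"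
| "drift \<mu> x (Suc n) = (drift \<mu> x n)(n := x n + \<mu> n (drift \<mu> x n))"

text \<open>The Girsanov exponent: the logarithm of the density of the drifted noise with respect to
  the undrifted one.\<close>

definition log_ratio :: "real \<Rightarrow> (nat \<Rightarrow> (nat \<Rightarrow> real) \<Rightarrow> real) \<Rightarrow> nat \<Rightarrow> (nat \<Rightarrow> real) \<Rightarrow> real" where
  "log_ratio \<sigma> \<mu> n x = (\<Sum>t<n. (\<mu> t x * x t - (\<mu> t x)\<^sup>2 / 2) / \<sigma>\<^sup>2)"

lemma predictable_cong: "predictable \<mu> n \<Longrightarrow> t < n \<Longrightarrow> (\<And>s. s < t \<Longrightarrow> x s = y s) \<Longrightarrow> \<mu> t x = \<mu> t y"
  unfolding predictable_def by meson

text \<open>Since \<open>\<mu> t\<close> ignores the coordinates from \<open>t\<close> on, those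
  from \<open>k\<close> on may be replaced by 0, and this factors it through the first
  \<open>k\<close> coordinates.\<close>

lemma predictable_less:
  assumes "predictable \<mu> n" "t < n" "t \<le> k"
  shows "\<mu> t \<in> borel_measurable (\<Pi>\<^sub>M s\<in>{..<k}. borel)"
proof -
  have [measurable]: "\<mu> t \<in> borel_measurable (\<Pi>\<^sub>M s\<in>{..<n}. borel)"
    using assms by (auto simp: predictable_def)
  have "\<mu> t = (\<lambda>x. \<mu> t (\<lambda>s\<in>{..<n}. if s < k then x s else 0))"
  proof
    fix x
    show "\<mu> t x = \<mu> t (\<lambda>s\<in>{..<n}. if s < k then x s else 0)"
      by (rule predictable_cong[OF assms(1,2)]) (use assms in auto)
  qed
  moreover have "(\<lambda>x. \<mu> t (\<lambda>s\<in>{..<n}. if s < k then x s else 0)) \<in> borel_measurable (\<Pi>\<^sub>M s\<in>{..<k}. borel)"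
  proof -
    have [measurable]: "(\<lambda>x. if s < k then x s else 0) \<in> borel_measurable (\<Pi>\<^sub>M s\<in>{..<k}. borel)"
      if "s < n" for s :: nat
      by (cases "s < k") auto
    have "(\<lambda>x. \<lambda>s\<in>{..<n}. if s < k then x s else 0) \<in> (\<Pi>\<^sub>M s\<in>{..<k}. borel) \<rightarrow>\<^sub>M (\<Pi>\<^sub>M s\<in>{..<n}. borel)"
      by (rule measurable_restrict) auto
    then show ?thesis
      by (rule measurable_compose) measurable
  qed
  ultimately show ?thesis by simp
qed

lemma predictable_mono: "predictable \<mu> n \<Longrightarrow> k \<le> n \<Longrightarrow> predictable \<mu> k"
  unfolding predictable_def[of \<mu> k]
  by (intro allI impI conjI predictable_less[of \<mu> n] predictable_cong[of \<mu> n]) auto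

lemma predictable_upd: "predictable \<mu> n \<Longrightarrow> t < n \<Longrightarrow> t \<le> s \<Longrightarrow> \<mu> t (x(s := y)) = \<mu> t x"
  by (rule predictable_cong) auto

lemma drift_cong: "(\<And>t. t < n \<Longrightarrow> x t = y t) \<Longrightarrow> drift \<mu> x n = drift \<mu> y n"
  by (induction n) auto

lemma drift_le: "t < k \<Longrightarrow> k \<le> n \<Longrightarrow> drift \<mu> x n t = drift \<mu> x k t"
proof (induction n)
  case (Suc n)
  then show ?case by (cases "k = Suc n") auto
qed simp

text \<open>The recursion evaluates \<open>\<mu> t\<close> on the prefix built so far, and by
  predictability the finished sequence gives the same value. The drifted path thus solves an
  implicit equation whose drift depends on the path itself.\<close>

lemma drift_eq:
  assumes "predictable \<mu> n" "t < n"
  shows "drift \<mu> x n t = x t + \<mu> t (drift \<mu> x n)"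
proof -
  have "drift \<mu> x n t = x t + \<mu> t (drift \<mu> x t)"
    using assms drift_le[of t "Suc t" n \<mu> x] by simp
  moreover have "\<mu> t (drift \<mu> x t) = \<mu> t (drift \<mu> x n)"
    by (rule predictable_cong[OF assms]) (use assms drift_le[of _ t n \<mu> x] in auto)
  ultimately show ?thesis by simp
qed

lemma drift_measurable [measurable]:
  "predictable \<mu> n \<Longrightarrow> (\<lambda>x. drift \<mu> x n) \<in> (\<Pi>\<^sub>M s\<in>{..<n}. borel) \<rightarrow>\<^sub>M (\<Pi>\<^sub>M s\<in>{..<n}. borel)"
proof (induction n)
  case 0
  show ?case by (auto simp: space_PiM intro!: measurable_PiM_single')
next
  case (Suc n)
  have 1: "(\<lambda>x. restrict x {..<n}) \<in> (\<Pi>\<^sub>M s\<in>{..<Suc n}. borel) \<rightarrow>\<^sub>M (\<Pi>\<^sub>M s\<in>{..<n}. borel)"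
    by (rule measurable_restrict_subset) auto
  have 2: "drift \<mu> x n = drift \<mu> (restrict x {..<n}) n" for x
    by (rule drift_cong) auto
  have [measurable]: "(\<lambda>x. drift \<mu> x n) \<in> (\<Pi>\<^sub>M s\<in>{..<Suc n}. borel) \<rightarrow>\<^sub>M (\<Pi>\<^sub>M s\<in>{..<n}. borel)"
    by (subst 2, rule measurable_compose[OF 1 Suc.IH]) (use Suc.prems predictable_mono in auto)
  have [measurable]: "\<mu> n \<in> borel_measurable (\<Pi>\<^sub>M s\<in>{..<n}. borel)"
    using predictable_less[OF Suc.prems, of n n] by simp
  show ?case
    unfolding drift.simps lessThan_Suc
    by (rule measurable_fun_upd[where J = "{..<n}"]) (auto simp flip: lessThan_Suc)
qed

text \<open>Once the history is fixed, the drift of the last coordinate is a constant and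
  \<open>nn_integral_gaussian_shift\<close> applies. \<open>f\<close> is arbitrary in the induction
  because the hypothesis is used for \<open>f\<close> integrated over the last coordinate.\<close>

lemma girsanov_nn_integral:
  assumes "0 < \<sigma>"
  shows "predictable \<mu> n \<Longrightarrow> f \<in> borel_measurable (\<Pi>\<^sub>M s\<in>{..<n}. borel) \<Longrightarrow>
    (\<integral>\<^sup>+x. f (drift \<mu> x n) \<partial>iid (gaussian \<sigma>) n) =
    (\<integral>\<^sup>+x. f x * ennreal (exp (log_ratio \<sigma> \<mu> n x)) \<partial>iid (gaussian \<sigma>) n)"
proof (induction n arbitrary: f)
  case 0
  interpret product_sigma_finite "\<lambda>_::nat. gaussian \<sigma>"
    by (simp add: product_sigma_finite_def prob_space_gaussian[OF assms] prob_space_imp_sigma_finite)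
  show ?case by (simp add: PiM_empty nn_integral_count_space_finite log_ratio_def)
next
  case (Suc n)
  interpret product_sigma_finite "\<lambda>_::nat. gaussian \<sigma>"
    by (simp add: product_sigma_finite_def prob_space_gaussian[OF assms] prob_space_imp_sigma_finite)
  interpret G: sigma_finite_measure "gaussian \<sigma>"
    by (simp add: prob_space_gaussian[OF assms] prob_space_imp_sigma_finite)
  have pn: "predictable \<mu> n" using Suc.prems predictable_mono by auto
  have s: "sets (iid (gaussian \<sigma>) n) = sets (\<Pi>\<^sub>M s\<in>{..<n}. borel)"
    "sets (Pi\<^sub>M (insert n {..<n}) (\<lambda>_. gaussian \<sigma>)) = sets (Pi\<^sub>M {..<Suc n} (\<lambda>_. borel))" for n
    by (auto intro!: sets_PiM_cong)
  note [measurable_cong] = s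
  have [measurable]: "f \<in> borel_measurable (\<Pi>\<^sub>M s\<in>{..<Suc n}. borel)" by fact
  have fm: "f \<in> borel_measurable (\<Pi>\<^sub>M s\<in>insert n {..<n}. borel)"
    using Suc.prems by (simp add: lessThan_Suc)
  have m[measurable]: "\<mu> t \<in> borel_measurable (\<Pi>\<^sub>M s\<in>{..<n}. borel)" if "t \<le> n" for t
    using predictable_less[OF Suc.prems(1), of t n] that by simp
  have m'[measurable]: "\<mu> t \<in> borel_measurable (\<Pi>\<^sub>M s\<in>{..<Suc n}. borel)" if "t \<le> n" for t
    using predictable_less[OF Suc.prems(1), of t "Suc n"] that by simp
  have lm[measurable]: "log_ratio \<sigma> \<mu> n \<in> borel_measurable (\<Pi>\<^sub>M s\<in>{..<n}. borel)"
    unfolding log_ratio_def by measurable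
  have lm'[measurable]: "log_ratio \<sigma> \<mu> (Suc n) \<in> borel_measurable (\<Pi>\<^sub>M s\<in>{..<Suc n}. borel)"
    unfolding log_ratio_def by measurable
  have upd[measurable]: "(\<lambda>z. (fst z)(n := h z)) \<in> (\<Pi>\<^sub>M s\<in>{..<n}. borel) \<Otimes>\<^sub>M borel \<rightarrow>\<^sub>M (\<Pi>\<^sub>M s\<in>{..<Suc n}. borel)"
    if [measurable]: "h \<in> borel_measurable ((\<Pi>\<^sub>M s\<in>{..<n}. borel) \<Otimes>\<^sub>M borel)" for h :: "_ \<Rightarrow> real"
    unfolding lessThan_Suc by (rule measurable_fun_upd[where J = "{..<n}"]) auto
  have upd'[measurable]: "(\<lambda>y. x(n := y)) \<in> borel \<rightarrow>\<^sub>M (\<Pi>\<^sub>M s\<in>{..<Suc n}. borel)"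
    if "x \<in> space (\<Pi>\<^sub>M s\<in>{..<n}. borel)" for x :: "nat \<Rightarrow> real"
    unfolding lessThan_Suc by (rule measurable_fun_upd[where J = "{..<n}"]) (use that in auto)
  \<comment> \<open>The average of \<open>f\<close> over the last drifted coordinate, as a function
    of a history that has already drifted.\<close>
  define g where "g = (\<lambda>x. \<integral>\<^sup>+y. f (x(n := y + \<mu> n x)) \<partial>gaussian \<sigma>)"
  have gm: "g \<in> borel_measurable (\<Pi>\<^sub>M s\<in>{..<n}. borel)"
    unfolding g_def
    by measurable
  have dm: "(\<lambda>x. f (drift \<mu> x (Suc n))) \<in> borel_measurable (iid (gaussian \<sigma>) (Suc n))"
    using measurable_compose[OF drift_measurable[OF Suc.prems(1)] Suc.prems(2)] by measurable
  have "(\<integral>\<^sup>+x. f (drift \<mu> x (Suc n)) \<partial>iid (gaussian \<sigma>) (Suc n)) =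
      (\<integral>\<^sup>+x. (\<integral>\<^sup>+y. f (drift \<mu> (x(n := y)) (Suc n)) \<partial>gaussian \<sigma>) \<partial>iid (gaussian \<sigma>) n)"
    unfolding lessThan_Suc
    by (rule product_nn_integral_insert)
       (use dm in \<open>auto simp del: drift.simps simp flip: lessThan_Suc\<close>)
  also have "\<dots> = (\<integral>\<^sup>+x. g (drift \<mu> x n) \<partial>iid (gaussian \<sigma>) n)"
  proof -
    have "drift \<mu> (x(n := y)) n = drift \<mu> x n" for x y by (rule drift_cong) auto
    then show ?thesis by (simp add: g_def)
  qed
  also have "\<dots> = (\<integral>\<^sup>+x. g x * ennreal (exp (log_ratio \<sigma> \<mu> n x)) \<partial>iid (gaussian \<sigma>) n)"
    by (rule Suc.IH[OF pn gm])
  also have "\<dots> = (\<integral>\<^sup>+x. (\<integral>\<^sup>+y. f (x(n := y)) * ennreal (exp (log_ratio \<sigma> \<mu> (Suc n) (x(n := y))))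
      \<partial>gaussian \<sigma>) \<partial>iid (gaussian \<sigma>) n)"
  proof (rule nn_integral_cong)
    fix x assume "x \<in> space (iid (gaussian \<sigma>) n)"
    then have [measurable]: "x \<in> space (\<Pi>\<^sub>M s\<in>{..<n}. borel)" by (simp add: space_PiM)
    \<comment> \<open>Earlier drifts do not see coordinate \<open>n\<close>, so the exponent splits
      into one new summand and a part that is constant in \<open>y\<close>.\<close>
    have lr: "log_ratio \<sigma> \<mu> (Suc n) (x(n := y)) =
        (\<mu> n x * y - (\<mu> n x)\<^sup>2 / 2) / \<sigma>\<^sup>2 + log_ratio \<sigma> \<mu> n x" for y
      using Suc.prems(1) by (simp add: log_ratio_def predictable_upd)
    have "g x = (\<integral>\<^sup>+y. f (x(n := y)) * ennreal (exp ((\<mu> n x * y - (\<mu> n x)\<^sup>2 / 2) / \<sigma>\<^sup>2)) \<partial>gaussian \<sigma>)"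
      unfolding g_def by (rule nn_integral_gaussian_shift[OF assms]) measurable
    then show "g x * ennreal (exp (log_ratio \<sigma> \<mu> n x)) =
        (\<integral>\<^sup>+y. f (x(n := y)) * ennreal (exp (log_ratio \<sigma> \<mu> (Suc n) (x(n := y)))) \<partial>gaussian \<sigma>)"
      by (simp add: lr exp_add ennreal_mult' mult.assoc flip: nn_integral_multc)
  qed
  also have "\<dots> = (\<integral>\<^sup>+x. f x * ennreal (exp (log_ratio \<sigma> \<mu> (Suc n) x)) \<partial>iid (gaussian \<sigma>) (Suc n))"
    unfolding lessThan_Suc
    by (rule product_nn_integral_insert[symmetric]) (auto simp flip: lessThan_Suc)
  finally show ?case .
qed

section \<open>Relative entropy and the effect of a drift on bounded statistics\<close>

lemma sets_iid_gaussian [measurable_cong]: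
  "sets (iid (gaussian \<sigma>) n) = sets (\<Pi>\<^sub>M s\<in>{..<n}. borel)"
  by (auto intro!: sets_PiM_cong)

lemma prob_space_iid: "prob_space \<nu> \<Longrightarrow> prob_space (iid \<nu> n)"
  by (rule prob_space_PiM)

text \<open>The orthogonality of martingale differences: \<open>\<mu> t\<close> does not depend on
  coordinate \<open>t\<close>, which by Fubini can be integrated first and has mean 0.\<close>

lemma integral_predictable_mult_noise:
  assumes \<sigma>: "0 < \<sigma>" and p: "predictable \<mu> n" and t: "t < n"
    and C: "\<And>x. \<bar>\<mu> t x\<bar> \<le> C"
  shows "integrable (iid (gaussian \<sigma>) n) (\<lambda>x. \<mu> t x * x t)" "(\<integral>x. \<mu> t x * x t \<partial>iid (gaussian \<sigma>) n) = 0"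
proof -
  interpret product_prob_space "\<lambda>_::nat. gaussian \<sigma>" "{..<n}"
    by (intro product_prob_spaceI prob_space_gaussian \<sigma>)
  have [measurable]: "\<mu> t \<in> borel_measurable (\<Pi>\<^sub>M s\<in>{..<n}. borel)"
    using predictable_less[OF p t] t by simp
  have tn: "t \<in> {..<n}" using t by simp
  have 1: "integrable (iid (gaussian \<sigma>) n) (\<lambda>x. x t)"
  proof -
    have "integrable (distr (iid (gaussian \<sigma>) n) (gaussian \<sigma>) (\<lambda>x. x t)) (\<lambda>x. x)"
      using PiM_component[OF tn] gaussian_moments(1)[OF \<sigma>] by simp
    moreover have "(\<lambda>x. x t) \<in> iid (gaussian \<sigma>) n \<rightarrow>\<^sub>M gaussian \<sigma>"
      using tn by (rule measurable_component_singleton)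
    ultimately show ?thesis by (simp add: integrable_distr_eq)
  qed
  show int: "integrable (iid (gaussian \<sigma>) n) (\<lambda>x. \<mu> t x * x t)"
  proof (rule Bochner_Integration.integrable_bound)
    show "integrable (iid (gaussian \<sigma>) n) (\<lambda>x. C * x t)" using 1 by simp
    show "(\<lambda>x. \<mu> t x * x t) \<in> borel_measurable (iid (gaussian \<sigma>) n)" using tn by measurable
    have "norm (\<mu> t x * x t) \<le> norm (C * x t)" for x
      using C[of x] by (auto simp: abs_mult intro!: mult_right_mono)
    then show "AE x in iid (gaussian \<sigma>) n. norm (\<mu> t x * x t) \<le> norm (C * x t)" by simp
  qed
  have n: "insert t ({..<n} - {t}) = {..<n}" using t by auto
  have "(\<integral>x. \<mu> t x * x t \<partial>iid (gaussian \<sigma>) n) =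
      (\<integral>x. (\<integral>y. \<mu> t (x(t := y)) * (x(t := y)) t \<partial>gaussian \<sigma>) \<partial>(\<Pi>\<^sub>M s\<in>{..<n} - {t}. gaussian \<sigma>))"
    using product_integral_insert[of "{..<n} - {t}" t, unfolded n, OF _ _ int] by simp
  also have "\<dots> = 0"
    using gaussian_moments(2)[OF \<sigma>] by (simp add: predictable_upd[OF p t])
  finally show "(\<integral>x. \<mu> t x * x t \<partial>iid (gaussian \<sigma>) n) = 0" .
qed

text \<open>Up to sign, the last value is the relative entropy of the undrifted noise with respect
  to the drifted one. The squared drifts are averaged without drift, that is, in the reference
  environment.\<close>

lemma integral_log_ratio:
  assumes \<sigma>: "0 < \<sigma>" and p: "predictable \<mu> n" and C: "\<And>t x. t < n \<Longrightarrow> \<bar>\<mu> t x\<bar> \<le> C"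
  shows "integrable (iid (gaussian \<sigma>) n) (log_ratio \<sigma> \<mu> n)"
    "integrable (iid (gaussian \<sigma>) n) (\<lambda>x. \<Sum>t<n. (\<mu> t x)\<^sup>2)"
    "(\<integral>x. log_ratio \<sigma> \<mu> n x \<partial>iid (gaussian \<sigma>) n) =
      - (\<integral>x. (\<Sum>t<n. (\<mu> t x)\<^sup>2) \<partial>iid (gaussian \<sigma>) n) / (2 * \<sigma>\<^sup>2)"
proof -
  interpret prob_space "iid (gaussian \<sigma>) n"
    by (intro prob_space_iid prob_space_gaussian \<sigma>)
  have m[measurable]: "\<mu> t \<in> borel_measurable (\<Pi>\<^sub>M s\<in>{..<n}. borel)" if "t < n" for t
    using predictable_less[OF p, of t n] that by simp
  have 2: "integrable (iid (gaussian \<sigma>) n) (\<lambda>x. (\<mu> t x)\<^sup>2)" if "t < n" for t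
  proof (rule integrable_const_bound)
    show "AE x in iid (gaussian \<sigma>) n. norm ((\<mu> t x)\<^sup>2) \<le> C\<^sup>2"
      using C[OF that] by (auto simp: abs_le_square_iff[symmetric] intro: order_trans[OF _ abs_ge_self])
    show "(\<lambda>x. (\<mu> t x)\<^sup>2) \<in> borel_measurable (iid (gaussian \<sigma>) n)" using that by measurable
  qed
  then show s: "integrable (iid (gaussian \<sigma>) n) (\<lambda>x. \<Sum>t<n. (\<mu> t x)\<^sup>2)"
    by (intro Bochner_Integration.integrable_sum) simp
  note 1 = integral_predictable_mult_noise[OF \<sigma> p _ C]
  have eq: "log_ratio \<sigma> \<mu> n = (\<lambda>x. ((\<Sum>t<n. \<mu> t x * x t) - (\<Sum>t<n. (\<mu> t x)\<^sup>2) / 2) / \<sigma>\<^sup>2)"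
    by (simp add: log_ratio_def fun_eq_iff sum_subtractf flip: sum_divide_distrib)
  have i1: "integrable (iid (gaussian \<sigma>) n) (\<lambda>x. \<Sum>t<n. \<mu> t x * x t)"
    using 1(1) by (intro Bochner_Integration.integrable_sum) simp
  have i2: "(\<integral>x. (\<Sum>t<n. \<mu> t x * x t) \<partial>iid (gaussian \<sigma>) n) = 0"
    using 1 by (subst Bochner_Integration.integral_sum) auto
  show "integrable (iid (gaussian \<sigma>) n) (log_ratio \<sigma> \<mu> n)"
    unfolding eq using s i1 by simp
  show "(\<integral>x. log_ratio \<sigma> \<mu> n x \<partial>iid (gaussian \<sigma>) n) =
      - (\<integral>x. (\<Sum>t<n. (\<mu> t x)\<^sup>2) \<partial>iid (gaussian \<sigma>) n) / (2 * \<sigma>\<^sup>2)"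
  proof -
    have "(\<integral>x. log_ratio \<sigma> \<mu> n x \<partial>iid (gaussian \<sigma>) n) = ((\<integral>x. (\<Sum>t<n. \<mu> t x * x t) \<partial>iid (gaussian \<sigma>) n) -
        (\<integral>x. (\<Sum>t<n. (\<mu> t x)\<^sup>2) \<partial>iid (gaussian \<sigma>) n) / 2) / \<sigma>\<^sup>2"
      unfolding eq by (subst integral_divide_zero, subst Bochner_Integration.integral_diff)
        (use s i1 in \<open>auto simp: integral_divide_zero\<close>)
    then show ?thesis unfolding i2 by simp
  qed
qed

lemma measurable_log_ratio:
  assumes "predictable \<mu> n"
  shows "log_ratio \<sigma> \<mu> n \<in> borel_measurable (\<Pi>\<^sub>M s\<in>{..<n}. borel)"
proof -
  have [measurable]: "\<mu> t \<in> borel_measurable (\<Pi>\<^sub>M s\<in>{..<n}. borel)" if "t < n" for t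
    using predictable_less[OF assms, of t n] that by simp
  show ?thesis unfolding log_ratio_def by measurable
qed

lemma integral_drift:
  assumes \<sigma>: "0 < \<sigma>" and p: "predictable \<mu> n"
    and Xm: "X \<in> borel_measurable (\<Pi>\<^sub>M s\<in>{..<n}. borel)" and X: "\<And>x. \<bar>X x\<bar> \<le> 1"
  shows "integrable (iid (gaussian \<sigma>) n) (\<lambda>x. X x * exp (log_ratio \<sigma> \<mu> n x))"
    "(\<integral>x. X (drift \<mu> x n) \<partial>iid (gaussian \<sigma>) n) =
      (\<integral>x. X x * exp (log_ratio \<sigma> \<mu> n x) \<partial>iid (gaussian \<sigma>) n)"
proof -
  let ?P = "iid (gaussian \<sigma>) n" and ?Z = "\<lambda>x. exp (log_ratio \<sigma> \<mu> n x)"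
  interpret prob_space ?P
    by (intro prob_space_iid prob_space_gaussian \<sigma>)
  note [measurable] = measurable_log_ratio[OF p] drift_measurable[OF p]
  have nonneg: "integrable ?P (\<lambda>x. Y x * ?Z x) \<and>
      (\<integral>x. Y (drift \<mu> x n) \<partial>?P) = (\<integral>x. Y x * ?Z x \<partial>?P)"
    if [measurable]: "Y \<in> borel_measurable (\<Pi>\<^sub>M s\<in>{..<n}. borel)" and Y: "\<And>x. 0 \<le> Y x" "\<And>x. Y x \<le> 2" for Y
  proof -
    have i: "integrable ?P (\<lambda>x. Y (drift \<mu> x n))"
      by (rule integrable_const_bound[where B = 2]) (use Y in auto)
    have e: "(\<integral>\<^sup>+x. ennreal (Y (drift \<mu> x n)) \<partial>?P) = (\<integral>\<^sup>+x. ennreal (Y x * ?Z x) \<partial>?P)"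
      using girsanov_nn_integral[OF \<sigma> p, of "\<lambda>x. ennreal (Y x)"] Y by (simp add: ennreal_mult)
    have i': "integrable ?P (\<lambda>x. Y x * ?Z x)"
    proof (rule integrableI_nonneg)
      show "(\<integral>\<^sup>+x. ennreal (Y x * ?Z x) \<partial>?P) < \<infinity>"
        using e i Y by (simp add: nn_integral_eq_integral flip: e)
    qed (use Y in auto)
    moreover have "(\<integral>x. Y (drift \<mu> x n) \<partial>?P) = (\<integral>x. Y x * ?Z x \<partial>?P)"
      using e i i' Y by (simp add: integral_eq_nn_integral)
    ultimately show ?thesis by simp
  qed
  \<comment> \<open>Adding 1 makes \<open>X\<close> nonnegative and at most 2, so
    \<open>nonneg\<close> applies. The constant function 1 then shows that the density has mean 1,
    and a subtraction recovers \<open>X\<close>.\<close>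
  have a: "0 \<le> X x + 1" "X x + 1 \<le> 2" for x using X[of x] by auto
  have 1: "integrable ?P (\<lambda>x. (X x + 1) * ?Z x)"
    "(\<integral>x. X (drift \<mu> x n) + 1 \<partial>?P) = (\<integral>x. (X x + 1) * ?Z x \<partial>?P)"
    using nonneg[of "\<lambda>x. X x + 1"] a Xm by auto
  have 2: "integrable ?P ?Z" "1 = (\<integral>x. ?Z x \<partial>?P)"
    using nonneg[of "\<lambda>_. 1"] by (auto simp: prob_space)
  have eq: "(\<lambda>x. X x * ?Z x) = (\<lambda>x. (X x + 1) * ?Z x - ?Z x)" by (auto simp: algebra_simps)
  show "integrable ?P (\<lambda>x. X x * ?Z x)"
    unfolding eq using 1(1) 2(1) by (rule Bochner_Integration.integrable_diff)
  have "integrable ?P (\<lambda>x. X (drift \<mu> x n))"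
    by (rule integrable_const_bound[where B = 1]) (use X Xm in auto)
  then have "(\<integral>x. X (drift \<mu> x n) \<partial>?P) + 1 = (\<integral>x. (X x + 1) * ?Z x \<partial>?P)"
    using 1(2) by (simp add: prob_space)
  then show "(\<integral>x. X (drift \<mu> x n) \<partial>?P) = (\<integral>x. X x * ?Z x \<partial>?P)"
    unfolding eq using 1(1) 2 by (simp add: Bochner_Integration.integral_diff)
qed

text \<open>A linearized Pinsker inequality, by AM-GM on \<open>(s - 1) (s + 1)\<close> with \<open>s = exp (w / 2)\<close>.\<close>

lemma mult_exp_diff_le:
  fixes x w :: real
  assumes "\<bar>x\<bar> \<le> 1"
  shows "x * (exp w - 1) \<le> 16 * (exp w - 1 - w) + (exp w + 1) / 32"
proof -
  define s where "s = exp (w / 2)"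
  have s: "exp w = s\<^sup>2" "s > 0" "s \<ge> 1 + w / 2"
    by (auto simp: s_def power2_eq_square simp flip: exp_add)
  have "x * (exp w - 1) \<le> \<bar>x * (exp w - 1)\<bar>" by simp
  also have "\<dots> \<le> 1 * \<bar>s\<^sup>2 - 1\<bar>"
    unfolding abs_mult s(1) using assms by (intro mult_right_mono) auto
  also have "\<dots> = \<bar>s - 1\<bar> * (s + 1)"
  proof -
    have "s\<^sup>2 - 1 = (s - 1) * (s + 1)" by (simp add: power2_eq_square algebra_simps)
    then show ?thesis using s(2) by (simp add: abs_mult)
  qed
  also have "\<dots> \<le> 16 * (s - 1)\<^sup>2 + (s + 1)\<^sup>2 / 64"
  proof -
    have "a * b \<le> 16 * a\<^sup>2 + b\<^sup>2 / 64" for a b :: real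
      using zero_le_power2[of "4 * a - b / 8"] by (simp add: power2_eq_square algebra_simps)
    from this[of "\<bar>s - 1\<bar>" "s + 1"] show ?thesis by simp
  qed
  also have "\<dots> \<le> 16 * (s\<^sup>2 - 1 - w) + (s\<^sup>2 + 1) / 32"
  proof -
    have "(s - 1)\<^sup>2 \<le> s\<^sup>2 - 1 - w" using s(3) by (simp add: power2_diff)
    moreover have "(s + 1)\<^sup>2 \<le> 2 * (s\<^sup>2 + 1)"
      using zero_le_power2[of "s - 1"] by (simp add: power2_diff power2_sum)
    moreover have "16 * a + b / 64 \<le> 16 * p + q / 32" if "a \<le> p" "b \<le> 2 * q" for a b p q :: real
      using that by linarith
    ultimately show ?thesis by blast
  qed
  finally show ?thesis by (simp add: s(1))
qed

text \<open>Averages \<open>mult_exp_diff_le\<close> with the log-ratio as \<open>w\<close>. The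
  density has mean 1, so \<open>(exp w + 1) / 32\<close> contributes 1/16, and
  \<open>16 * (exp w - 1 - w)\<close> contributes 16 times the relative entropy, whence the factor
  \<open>8 / \<sigma>\<^sup>2\<close>.\<close>

lemma integral_drift_le:
  assumes \<sigma>: "0 < \<sigma>" and p: "predictable \<mu> n" and C: "\<And>t x. t < n \<Longrightarrow> \<bar>\<mu> t x\<bar> \<le> C"
    and Xm: "X \<in> borel_measurable (\<Pi>\<^sub>M s\<in>{..<n}. borel)" and X: "\<And>x. \<bar>X x\<bar> \<le> 1"
  shows "(\<integral>x. X (drift \<mu> x n) \<partial>iid (gaussian \<sigma>) n) \<le> (\<integral>x. X x \<partial>iid (gaussian \<sigma>) n) + 1 / 16
     + 8 / \<sigma>\<^sup>2 * (\<integral>x. (\<Sum>t<n. (\<mu> t x)\<^sup>2) \<partial>iid (gaussian \<sigma>) n)"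
proof -
  let ?P = "iid (gaussian \<sigma>) n" and ?W = "log_ratio \<sigma> \<mu> n"
  interpret prob_space ?P
    by (intro prob_space_iid prob_space_gaussian \<sigma>)
  have W: "integrable ?P ?W" by (rule integral_log_ratio[OF \<sigma> p C])
  have Z: "integrable ?P (\<lambda>x. exp (?W x))" "(\<integral>x. exp (?W x) \<partial>?P) = 1"
    using integral_drift[OF \<sigma> p, of "\<lambda>_. 1"] by (auto simp: prob_space)
  have iX: "integrable ?P X"
    by (rule integrable_const_bound[where B = 1]) (use X Xm in auto)
  have "(\<integral>x. X (drift \<mu> x n) \<partial>?P) = (\<integral>x. X x * exp (?W x) \<partial>?P)"
    by (rule integral_drift[OF \<sigma> p Xm X])
  also have "\<dots> \<le> (\<integral>x. X x + (16 * (exp (?W x) - 1 - ?W x) + (exp (?W x) + 1) / 32) \<partial>?P)"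
  proof (rule integral_mono)
    show "integrable ?P (\<lambda>x. X x * exp (?W x))" by (rule integral_drift[OF \<sigma> p Xm X])
    show "integrable ?P (\<lambda>x. X x + (16 * (exp (?W x) - 1 - ?W x) + (exp (?W x) + 1) / 32))"
      using W Z iX by simp
    show "X x * exp (?W x) \<le> X x + (16 * (exp (?W x) - 1 - ?W x) + (exp (?W x) + 1) / 32)" for x
      using mult_exp_diff_le[OF X, of x "?W x"] by (simp add: algebra_simps)
  qed
  also have "\<dots> = (\<integral>x. X x \<partial>?P) + (16 * (1 - 1 - (\<integral>x. ?W x \<partial>?P)) + (1 + 1) / 32)"
    using W Z iX by (simp add: prob_space)
  also have "(\<integral>x. ?W x \<partial>?P) = - (\<integral>x. (\<Sum>t<n. (\<mu> t x)\<^sup>2) \<partial>?P) / (2 * \<sigma>\<^sup>2)"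
    by (rule integral_log_ratio[OF \<sigma> p C])
  finally show ?thesis by (simp add: algebra_simps)
qed

section \<open>The interaction of learner and environment\<close>

lemma length_feedback [simp]: "length (feedback L B \<theta> u \<xi> m) = m"
  by (induction m) (simp_all add: Let_def)

lemma feedback_cong:
  "(\<And>s. s < m * B \<Longrightarrow> x s = y s) \<Longrightarrow> feedback L B \<theta> u x m = feedback L B \<theta> u y m"
proof (induction m)
  case (Suc m)
  have "feedback L B \<theta> u x m = feedback L B \<theta> u y m"
    by (rule Suc.IH) (use Suc.prems in auto)
  moreover have "x (m * B + j) = y (m * B + j)" if "j < B" for j
    using Suc.prems[of "m * B + j"] that by simp
  ultimately show ?case by (simp add: Let_def cong: restrict_cong)
qed simp

text \<open>Batching only delays information: for a fixed seed the action is determined by the noise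
  before the start of its batch, hence before \<open>t\<close>. This causality makes the drifts
  below predictable.\<close>

lemma action_at_cong:
  assumes "\<And>s. s < t \<Longrightarrow> x s = y s"
  shows "action_at L B \<theta> u x t = action_at L B \<theta> u y t"
proof -
  have "feedback L B \<theta> u x (t div B) = feedback L B \<theta> u y (t div B)"
  proof (rule feedback_cong)
    fix s assume "s < t div B * B"
    then have "s < t" using div_times_less_eq_dividend[of t B] by linarith
    then show "x s = y s" by (rule assms)
  qed
  then show ?thesis by (simp add: action_at_def)
qed

locale bandit =
  fixes d T B :: nat and A :: "rvec set" and L :: learner
  assumes T: "1 \<le> T" and B: "1 \<le> B"
    and finite_A: "finite A" and A_carrier: "A \<subseteq> carrier_vec d"
    and A_norm: "\<And>a. a \<in> A \<Longrightarrow> l2_norm a \<le> 1"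
    and valid: "valid_learner T B A L"
begin

section \<open>Measurability of the interaction\<close>

lemma seed_prob_space: "prob_space (seed_law L)"
  and sets_seed [measurable_cong]: "sets (seed_law L) = sets borel"
  and play_measurable: "t < T \<Longrightarrow> length h = t div B \<Longrightarrow>
    (\<lambda>u. play L u h t) \<in> borel \<rightarrow>\<^sub>M count_space A"
  and quantizer_measurable: "length h < num_batches T B \<Longrightarrow> (\<lambda>(u, y). quantizer L u h y)
    \<in> borel \<Otimes>\<^sub>M (\<Pi>\<^sub>M j\<in>{..<B}. borel) \<rightarrow>\<^sub>M count_space UNIV"
  using valid unfolding valid_learner_def by blast+

lemma play_in: "t < T \<Longrightarrow> length h = t div B \<Longrightarrow> play L u h t \<in> A"
  using measurable_space[OF play_measurable] by simp

lemma action_at_in: "t < T \<Longrightarrow> action_at L B \<theta> u \<xi> t \<in> A"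
  by (simp add: action_at_def play_in)

lemma A_nonempty: "A \<noteq> {}"
  using action_at_in[of 0] T by auto

lemma less_num_batches: "m * B < T \<Longrightarrow> m < num_batches T B"
proof -
  assume "m * B < T"
  then have "real m < real T / real B"
    using B by (simp add: field_simps flip: of_nat_mult)
  then show ?thesis unfolding num_batches_def by linarith
qed

text \<open>There are only finitely many histories of a given length. With the history frozen at
  \<open>h\<close>, one more step is measurable in seed and noise, and these maps are glued along
  the measurable history. The batches are complete, so all noise coordinates involved lie below
  \<open>T\<close>.\<close>

lemma feedback_measurable:
  assumes "m * B \<le> T"
  shows "(\<lambda>(u, \<xi>). feedback L B \<theta> u \<xi> m) \<in> borel \<Otimes>\<^sub>M (\<Pi>\<^sub>M t\<in>{..<T}. borel) \<rightarrow>\<^sub>M count_space {h. length h = m}"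
  using assms
proof (induction m)
  case (Suc m)
  let ?M = "borel \<Otimes>\<^sub>M (\<Pi>\<^sub>M t\<in>{..<T}. borel) :: (real \<times> (nat \<Rightarrow> real)) measure"
  have IH: "(\<lambda>(u, \<xi>). feedback L B \<theta> u \<xi> m) \<in> ?M \<rightarrow>\<^sub>M count_space {h. length h = m}"
    using Suc by simp
  have mT: "m * B < T" using Suc.prems B by simp
  define F where "F h z = h @ [quantizer L (fst z) h (\<lambda>j\<in>{..<B}.
    scalar_prod (play L (fst z) h (m * B + j)) \<theta> + snd z (m * B + j))]"
    for h and z :: "real \<times> (nat \<Rightarrow> real)"
  have F: "F h \<in> ?M \<rightarrow>\<^sub>M count_space {h. length h = Suc m}" if h: "h \<in> {h. length h = m}" for h
  proof -
    have [measurable]: "(\<lambda>z. scalar_prod (play L (fst z) h (m * B + j)) \<theta>) \<in> borel_measurable ?M"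
      "(\<lambda>z. snd z (m * B + j)) \<in> borel_measurable ?M"
      if "j < B" for j
    proof -
      have j: "m * B + j < T" "(m * B + j) div B = m" using that Suc.prems by auto
      show "(\<lambda>z. scalar_prod (play L (fst z) h (m * B + j)) \<theta>) \<in> borel_measurable ?M"
        using measurable_compose[OF measurable_fst measurable_compose[OF play_measurable[of "m * B + j" h], of "\<lambda>a. scalar_prod a \<theta>" borel]]
          j h by simp
      show "(\<lambda>z. snd z (m * B + j)) \<in> borel_measurable ?M"
        by (rule measurable_compose[OF measurable_snd measurable_component_singleton]) (use j in simp)
    qed
    have "(\<lambda>z. (fst z, \<lambda>j\<in>{..<B}. scalar_prod (play L (fst z) h (m * B + j)) \<theta> + snd z (m * B + j)))
        \<in> ?M \<rightarrow>\<^sub>M borel \<Otimes>\<^sub>M (\<Pi>\<^sub>M j\<in>{..<B}. borel)"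
      by measurable
    from measurable_compose[OF this quantizer_measurable[of h]]
    have q: "(\<lambda>z. quantizer L (fst z) h (\<lambda>j\<in>{..<B}.
        scalar_prod (play L (fst z) h (m * B + j)) \<theta> + snd z (m * B + j))) \<in> ?M \<rightarrow>\<^sub>M count_space UNIV"
      using h less_num_batches[OF mT] by simp
    show ?thesis unfolding F_def
      by (rule measurable_compose[OF q]) (use h in auto)
  qed
  have "countable {h :: bool list. length h = m}" by simp
  from measurable_compose_countable'[where f = F, OF F IH this]
  have "(\<lambda>z. F ((\<lambda>(u, \<xi>). feedback L B \<theta> u \<xi> m) z) z) \<in> ?M \<rightarrow>\<^sub>M count_space {h. length h = Suc m}"
    by simp
  then show ?case by (simp add: F_def Let_def case_prod_beta')
qed simp

lemma action_at_measurable: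
  assumes t: "t < T"
  shows "(\<lambda>(u, \<xi>). action_at L B \<theta> u \<xi> t) \<in> borel \<Otimes>\<^sub>M (\<Pi>\<^sub>M t\<in>{..<T}. borel) \<rightarrow>\<^sub>M count_space A"
proof -
  have m: "t div B * B \<le> T" using t div_times_less_eq_dividend[of t B] by linarith
  have p: "(\<lambda>z. play L (fst z) h t) \<in> borel \<Otimes>\<^sub>M (\<Pi>\<^sub>M t\<in>{..<T}. borel) \<rightarrow>\<^sub>M count_space A"
    if "h \<in> {h. length h = t div B}" for h
    using measurable_compose[OF measurable_fst play_measurable[OF t]] that by simp
  have "countable {h :: bool list. length h = t div B}" by simp
  from measurable_compose_countable'[where f = "\<lambda>h z. play L (fst z) h t", OF p feedback_measurable[OF m] this]
  have "(\<lambda>z. play L (fst z) ((\<lambda>(u, \<xi>). feedback L B \<theta> u \<xi> (t div B)) z) t)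
      \<in> borel \<Otimes>\<^sub>M (\<Pi>\<^sub>M t\<in>{..<T}. borel) \<rightarrow>\<^sub>M count_space A"
    by simp
  then show ?thesis by (simp add: action_at_def case_prod_beta')
qed

lemma action_at_measurable':
  assumes t: "t < T"
  shows "(\<lambda>\<xi>. action_at L B \<theta> u \<xi> t) \<in> (\<Pi>\<^sub>M t\<in>{..<T}. borel) \<rightarrow>\<^sub>M count_space A"
  using measurable_compose[OF measurable_Pair1' action_at_measurable[OF t]] by simp

text \<open>A run under \<open>\<theta>\<close> is to be read as a run under
  \<open>\<theta>'\<close> whose noise has drifted by the difference of the mean rewards. The action
  is taken in the run under \<open>\<theta>'\<close>, so on the drifted noise; \<open>drift\<close>
  solves the resulting implicit equation.\<close>

definition gap_shift :: "rvec \<Rightarrow> rvec \<Rightarrow> real \<Rightarrow> nat \<Rightarrow> (nat \<Rightarrow> real) \<Rightarrow> real" where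
  "gap_shift \<theta> \<theta>' u t \<xi> = scalar_prod (action_at L B \<theta>' u \<xi> t) \<theta> - scalar_prod (action_at L B \<theta>' u \<xi> t) \<theta>'"

lemma predictable_gap_shift: "predictable (gap_shift \<theta> \<theta>' u) T"
  unfolding predictable_def
proof (intro allI impI conjI)
  fix t assume t: "t < T"
  show "gap_shift \<theta> \<theta>' u t \<in> borel_measurable (\<Pi>\<^sub>M s\<in>{..<T}. borel)"
    unfolding gap_shift_def
    by (rule measurable_compose[OF action_at_measurable'[OF t]]) simp
next
  fix t and x y :: "nat \<Rightarrow> real" assume "\<forall>s<t. x s = y s"
  then have "action_at L B \<theta>' u x t = action_at L B \<theta>' u y t"
    by (intro action_at_cong) simp
  then show "gap_shift \<theta> \<theta>' u t x = gap_shift \<theta> \<theta>' u t y"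
    by (simp add: gap_shift_def)
qed

text \<open>A pathwise identity, by induction over the batches: by \<open>drift_eq\<close> the two
  runs show the same rewards, hence the same bits and the same next actions.\<close>

lemma action_at_drift:
  assumes t: "t < T"
  shows "action_at L B \<theta> u \<xi> t = action_at L B \<theta>' u (drift (gap_shift \<theta> \<theta>' u) \<xi> T) t"
proof -
  let ?y = "drift (gap_shift \<theta> \<theta>' u) \<xi> T"
  have fb: "feedback L B \<theta> u \<xi> m = feedback L B \<theta>' u ?y m" if "m * B \<le> T" for m
    using that
  proof (induction m)
    case (Suc m)
    have IH: "feedback L B \<theta> u \<xi> m = feedback L B \<theta>' u ?y m"
      using Suc by simp
    have "scalar_prod (play L u (feedback L B \<theta>' u ?y m) (m * B + j)) \<theta> + \<xi> (m * B + j) =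
        scalar_prod (play L u (feedback L B \<theta>' u ?y m) (m * B + j)) \<theta>' + ?y (m * B + j)" if "j < B" for j
    proof -
      have "m * B + j < T" "(m * B + j) div B = m" using that Suc.prems by auto
      then show ?thesis
        using drift_eq[OF predictable_gap_shift, of "m * B + j" \<theta> \<theta>' u \<xi>]
        by (simp add: gap_shift_def action_at_def)
    qed
    then show ?case by (simp add: Let_def IH cong: restrict_cong)
  qed simp
  have "t div B * B \<le> T" using t div_times_less_eq_dividend[of t B] by linarith
  from fb[OF this] show ?thesis by (simp add: action_at_def)
qed

section \<open>Bounded regret and averaging over parameters\<close>

lemma best_action:
  shows "best_action A \<theta> \<in> A" "a \<in> A \<Longrightarrow> scalar_prod a \<theta> \<le> scalar_prod (best_action A \<theta>) \<theta>"
proof -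
  let ?f = "\<lambda>a. scalar_prod a \<theta>"
  have "Max (?f ` A) \<in> ?f ` A" using finite_A A_nonempty by (intro Max_in) auto
  then have "\<exists>a\<in>A. ?f a = Max (?f ` A)" by (metis imageE)
  then have "\<exists>a. is_arg_max ?f (\<lambda>a. a \<in> A) a"
    using finite_A by (metis Max_ge finite_imageI imageI is_arg_max_def not_less)
  then have "is_arg_max ?f (\<lambda>a. a \<in> A) (best_action A \<theta>)"
    unfolding best_action_def arg_max_on_def arg_max_def by (rule someI_ex)
  then show "best_action A \<theta> \<in> A" "a \<in> A \<Longrightarrow> ?f a \<le> ?f (best_action A \<theta>)"
    by (auto simp: is_arg_max_def not_less)
qed

lemma regret_eq:
  assumes "\<theta> \<in> carrier_vec d"
  shows "regret L T B A \<theta> u \<xi> =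
    (\<Sum>t<T. scalar_prod (best_action A \<theta>) \<theta> - scalar_prod (action_at L B \<theta> u \<xi> t) \<theta>)"
  unfolding regret_def
proof (rule sum.cong[OF refl])
  fix t assume "t \<in> {..<T}"
  then have "action_at L B \<theta> u \<xi> t \<in> carrier_vec d"
    using action_at_in A_carrier by auto
  moreover have "best_action A \<theta> \<in> carrier_vec d" using best_action(1) A_carrier by auto
  ultimately show "scalar_prod (best_action A \<theta> - action_at L B \<theta> u \<xi> t) \<theta> =
      scalar_prod (best_action A \<theta>) \<theta> - scalar_prod (action_at L B \<theta> u \<xi> t) \<theta>"
    using assms by (simp add: minus_scalar_prod_distrib)
qed

text \<open>Both norms are at most 1, so AM-GM in each coordinate can replace
  Cauchy-Schwarz.\<close>

lemma scalar_prod_le_1: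
  assumes "a \<in> carrier_vec d" "\<theta> \<in> carrier_vec d" "l2_norm a \<le> 1" "l2_norm \<theta> \<le> 1"
  shows "\<bar>scalar_prod a \<theta>\<bar> \<le> 1"
proof -
  have sq: "(\<Sum>i<d. (vec_index v i)\<^sup>2) \<le> 1" if "v \<in> carrier_vec d" "l2_norm v \<le> 1" for v :: rvec
    using that by (simp add: l2_norm_def scalar_prod_def power2_eq_square lessThan_atLeast0)
  have "\<bar>scalar_prod a \<theta>\<bar> \<le> (\<Sum>i<d. \<bar>vec_index a i * vec_index \<theta> i\<bar>)"
    using assms by (simp add: scalar_prod_def lessThan_atLeast0)
  also have "\<dots> \<le> (\<Sum>i<d. ((vec_index a i)\<^sup>2 + (vec_index \<theta> i)\<^sup>2) / 2)"
  proof (rule sum_mono)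
    have "\<bar>x * y\<bar> \<le> (x\<^sup>2 + y\<^sup>2) / 2" for x y :: real
      using zero_le_power2[of "\<bar>x\<bar> - \<bar>y\<bar>"] by (simp add: power2_diff abs_mult)
    then show "\<bar>vec_index a i * vec_index \<theta> i\<bar> \<le> ((vec_index a i)\<^sup>2 + (vec_index \<theta> i)\<^sup>2) / 2" for i .
  qed
  also have "\<dots> = ((\<Sum>i<d. (vec_index a i)\<^sup>2) + (\<Sum>i<d. (vec_index \<theta> i)\<^sup>2)) / 2"
    by (simp add: sum.distrib flip: sum_divide_distrib)
  also have "\<dots> \<le> 1" using sq[OF assms(1,3)] sq[OF assms(2,4)] by simp
  finally show ?thesis .
qed

text \<open>Boundedness makes the regret integrable and the real supremum in
  \<open>worst_case_regret\<close> a genuine upper bound.\<close>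

lemma regret_bounds:
  assumes "\<theta> \<in> carrier_vec d" "l2_norm \<theta> \<le> 1"
  shows "0 \<le> regret L T B A \<theta> u \<xi>" "regret L T B A \<theta> u \<xi> \<le> 2 * real T"
proof -
  show "0 \<le> regret L T B A \<theta> u \<xi>"
    unfolding regret_eq[OF assms(1)] by (intro sum_nonneg) (simp add: best_action action_at_in)
  have "\<bar>scalar_prod a \<theta>\<bar> \<le> 1" if "a \<in> A" for a
    using scalar_prod_le_1[of a \<theta>] that A_carrier A_norm assms by auto
  then have "regret L T B A \<theta> u \<xi> \<le> (\<Sum>t<T. 2)"
    unfolding regret_eq[OF assms(1)]
  proof (intro sum_mono)
    fix t assume *: "\<And>a. a \<in> A \<Longrightarrow> \<bar>scalar_prod a \<theta>\<bar> \<le> 1" and "t \<in> {..<T}"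
    then show "scalar_prod (best_action A \<theta>) \<theta> - scalar_prod (action_at L B \<theta> u \<xi> t) \<theta> \<le> 2"
      using *[OF best_action(1)[of \<theta>]] *[OF action_at_in, of t \<theta> u \<xi>]
      unfolding abs_le_iff by auto
  qed
  then show "regret L T B A \<theta> u \<xi> \<le> 2 * real T" by simp
qed

lemma regret_measurable:
  assumes "\<theta> \<in> carrier_vec d"
  shows "(\<lambda>(u, \<xi>). regret L T B A \<theta> u \<xi>) \<in> borel_measurable (borel \<Otimes>\<^sub>M (\<Pi>\<^sub>M t\<in>{..<T}. borel))"
proof -
  have [measurable]: "(\<lambda>z. scalar_prod (action_at L B \<theta> (fst z) (snd z) t) \<theta>)
      \<in> borel_measurable (borel \<Otimes>\<^sub>M (\<Pi>\<^sub>M t\<in>{..<T}. borel))" if "t < T" for t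
    using measurable_compose[OF action_at_measurable[OF that], of "\<lambda>a. scalar_prod a \<theta>" borel]
    by (simp add: case_prod_beta')
  show ?thesis unfolding regret_eq[OF assms] case_prod_beta'
    by measurable
qed

lemma integrable_regret:
  assumes "prob_space \<nu>" and s: "sets \<nu> = sets borel" and \<theta>: "\<theta> \<in> carrier_vec d" "l2_norm \<theta> \<le> 1"
  shows "integrable (iid \<nu> T) (\<lambda>\<xi>. regret L T B A \<theta> u \<xi>)"
proof -
  interpret prob_space "iid \<nu> T" by (rule prob_space_iid) fact
  have [measurable_cong]: "sets (iid \<nu> T) = sets (\<Pi>\<^sub>M t\<in>{..<T}. borel)"
    using s by (intro sets_PiM_cong) auto
  have "(\<lambda>\<xi>. regret L T B A \<theta> u \<xi>) \<in> borel_measurable (\<Pi>\<^sub>M t\<in>{..<T}. borel)"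
    using measurable_compose[OF measurable_Pair1' regret_measurable[OF \<theta>(1)]] by simp
  then have "(\<lambda>\<xi>. regret L T B A \<theta> u \<xi>) \<in> borel_measurable (iid \<nu> T)" by measurable
  then show ?thesis
    by (rule integrable_const_bound[where B = "2 * real T", rotated]) (use regret_bounds[OF \<theta>] in auto)
qed

text \<open>The supremum dominates the average over a finite family, and by Fubini the seed can be
  integrated last. A bound for every fixed seed therefore suffices, as if the learner were
  deterministic.\<close>

lemma worst_case_regret_ge:
  assumes "prob_space \<nu>" and [measurable_cong]: "sets \<nu> = sets borel"
    and \<Theta>: "finite \<Theta>" "\<Theta> \<noteq> {}" "\<And>I. I \<in> \<Theta> \<Longrightarrow> \<theta> I \<in> carrier_vec d \<and> l2_norm (\<theta> I) \<le> 1"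
    and avg: "\<And>u. (\<integral>\<xi>. (\<Sum>I\<in>\<Theta>. regret L T B A (\<theta> I) u \<xi>) \<partial>iid \<nu> T) \<ge> real (card \<Theta>) * r"
  shows "worst_case_regret \<nu> L d T B A \<ge> r"
proof -
  interpret N: prob_space "iid \<nu> T" by (rule prob_space_iid) fact
  interpret S: prob_space "seed_law L" by (rule seed_prob_space)
  interpret pair_prob_space "seed_law L" "iid \<nu> T" ..
  have [measurable_cong]: "sets (iid \<nu> T) = sets (\<Pi>\<^sub>M t\<in>{..<T}. borel)"
    using assms(2) by (intro sets_PiM_cong) auto
  let ?S = "{\<theta> \<in> carrier_vec d. l2_norm \<theta> \<le> 1}"
  have int: "integrable (seed_law L \<Otimes>\<^sub>M iid \<nu> T) (\<lambda>(u, \<xi>). regret L T B A \<theta> u \<xi>)" if "\<theta> \<in> ?S" for \<theta>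
  proof (rule integrable_const_bound[where B = "2 * real T"])
    show "AE x in seed_law L \<Otimes>\<^sub>M iid \<nu> T. norm (case x of (u, \<xi>) \<Rightarrow> regret L T B A \<theta> u \<xi>) \<le> 2 * real T"
      using regret_bounds[of \<theta>] that by (auto simp: split_beta')
    show "(\<lambda>(u, \<xi>). regret L T B A \<theta> u \<xi>) \<in> borel_measurable (seed_law L \<Otimes>\<^sub>M iid \<nu> T)"
    proof -
      have "sets (seed_law L \<Otimes>\<^sub>M iid \<nu> T) = sets (borel \<Otimes>\<^sub>M (\<Pi>\<^sub>M t\<in>{..<T}. borel))"
        using assms(2) by (intro sets_pair_measure_cong sets_PiM_cong sets_seed) auto
      then show ?thesis
        using regret_measurable[of \<theta>] that by (simp cong: measurable_cong_sets)
    qed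
  qed
  have bdd: "bdd_above (expected_regret \<nu> L T B A ` ?S)"
  proof (rule bdd_aboveI2)
    fix \<theta> assume "\<theta> \<in> ?S"
    then show "expected_regret \<nu> L T B A \<theta> \<le> 2 * real T"
      unfolding expected_regret_def
      by (intro integral_le_const int) (use regret_bounds[of \<theta>] in \<open>auto simp: split_beta'\<close>)
  qed
  have isum: "integrable (seed_law L \<Otimes>\<^sub>M iid \<nu> T) (\<lambda>(u, \<xi>). \<Sum>I\<in>\<Theta>. regret L T B A (\<theta> I) u \<xi>)"
    using int \<Theta>(3) by (simp add: case_prod_beta')
  have "real (card \<Theta>) * r = (\<integral>u. real (card \<Theta>) * r \<partial>seed_law L)"
    by (simp add: S.prob_space)
  also have "\<dots> \<le> (\<integral>u. (\<integral>\<xi>. (\<Sum>I\<in>\<Theta>. regret L T B A (\<theta> I) u \<xi>) \<partial>iid \<nu> T) \<partial>seed_law L)"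
    by (rule integral_mono[OF _ integrable_fst[OF isum] avg]) simp
  also have "\<dots> = (\<integral>(u, \<xi>). (\<Sum>I\<in>\<Theta>. regret L T B A (\<theta> I) u \<xi>) \<partial>(seed_law L \<Otimes>\<^sub>M iid \<nu> T))"
    by (rule integral_fst[OF isum])
  also have "\<dots> = (\<Sum>I\<in>\<Theta>. expected_regret \<nu> L T B A (\<theta> I))"
    unfolding expected_regret_def case_prod_beta'
    by (subst Bochner_Integration.integral_sum) (use int \<Theta>(3) in \<open>auto simp: case_prod_beta'\<close>)
  also have "\<dots> \<le> (\<Sum>I\<in>\<Theta>. worst_case_regret \<nu> L d T B A)"
    unfolding worst_case_regret_def using \<Theta>(3)
    by (intro sum_mono cSUP_upper bdd) auto
  also have "\<dots> = real (card \<Theta>) * worst_case_regret \<nu> L d T B A" by simp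
  finally show ?thesis using \<Theta> by (simp add: card_gt_0_iff)
qed

end

section \<open>Lower bounds for block-structured actions\<close>

text \<open>Redrawing one coordinate of a uniform function leaves it uniform: exchanging the old and
  the new value is an involution on the pairs of function and value.\<close>

lemma sum_PiE_resample:
  fixes f :: "('a \<Rightarrow> 'b) \<Rightarrow> real"
  assumes "b \<in> S"
  shows "(\<Sum>I\<in>PiE S (\<lambda>_. K). \<Sum>i\<in>K. f (I(b := i))) = real (card K) * (\<Sum>I\<in>PiE S (\<lambda>_. K). f I)"
proof -
  let ?\<Omega> = "PiE S (\<lambda>_. K)"
  have "(\<Sum>I\<in>?\<Omega>. \<Sum>i\<in>K. f (I(b := i))) = (\<Sum>(I, i)\<in>?\<Omega> \<times> K. f (I(b := i)))"
    by (rule sum.cartesian_product)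
  also have "\<dots> = (\<Sum>(I, i)\<in>?\<Omega> \<times> K. f I)"
    by (rule sum.reindex_bij_witness[where i = "\<lambda>(I, i). (I(b := i), I b)" and j = "\<lambda>(I, i). (I(b := i), I b)"])
      (use assms in \<open>auto simp: PiE_iff extensional_def\<close>)
  also have "\<dots> = (\<Sum>I\<in>?\<Omega>. \<Sum>i\<in>K. f I)"
    by (rule sum.cartesian_product[symmetric])
  finally show ?thesis by (simp add: sum_distrib_left)
qed

lemma exp_le_quadratic:
  fixes y :: real
  assumes "\<bar>y\<bar> \<le> c"
  shows "exp y \<le> 1 + y + y\<^sup>2 / 2 * exp c"
proof -
  obtain t where t: "\<bar>t\<bar> \<le> \<bar>y\<bar>" "exp y = (\<Sum>m<2. y ^ m / fact m) + exp t / fact 2 * y ^ 2"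
    using Maclaurin_exp_le[of y 2] by blast
  have "exp t \<le> exp c" using t(1) assms by simp
  then have "exp t / 2 * y\<^sup>2 \<le> exp c / 2 * y\<^sup>2" by (intro mult_right_mono) auto
  then show ?thesis using t(2) by (simp add: numeral_2_eq_2 algebra_simps)
qed

text \<open>Controls the quadratic term in \<open>block_mgf\<close>. The Taylor bound on
  \<open>exp (3 * u)\<close> exceeds \<open>6 * u\<close> because \<open>(3 * u - 1)\<close> squared
  is nonnegative.\<close>

lemma mult_exp_neg_le:
  fixes u :: real
  assumes "0 \<le> u"
  shows "u * exp (- (3 * u)) \<le> 1 / 6"
proof -
  have "6 * u \<le> 1 + 3 * u + (3 * u)\<^sup>2 / 2"
    using zero_le_power2[of "3 * u - 1"] by (simp add: power2_eq_square algebra_simps)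
  also have "\<dots> \<le> exp (3 * u)"
    using assms by (intro exp_lower_Taylor_quadratic) simp
  finally show ?thesis by (simp add: exp_minus field_simps)
qed

text \<open>\<open>x a b i\<close> is the reward, up to scale, that action \<open>a\<close> earns in block \<open>b\<close> when \<open>i\<close> is the
  good arm of that block; the index \<open>k\<close> encodes a block without signal.\<close>

definition block_features :: "nat \<Rightarrow> nat \<Rightarrow> nat \<Rightarrow> rvec set \<Rightarrow> (rvec \<Rightarrow> nat \<Rightarrow> nat \<Rightarrow> real) \<Rightarrow> bool" where
  "block_features d m k A x \<longleftrightarrow>
     (\<forall>a\<in>A. \<forall>b<m. x a b k = 0 \<and> (\<forall>i<k. \<bar>x a b i\<bar> \<le> 1) \<and>
        (\<Sum>i<k. x a b i) \<le> real k / 2 \<and> (\<Sum>i<k. (x a b i)\<^sup>2) \<le> 2) \<and>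
     (\<forall>I\<in>{..<m} \<rightarrow> {..<k}. \<exists>a\<in>A. \<forall>b<m. x a b (I b) = 1) \<and>
     (\<forall>\<delta>>0. real m * \<delta> \<le> 1 \<longrightarrow> (\<exists>\<theta>. \<forall>I\<in>{..<m} \<rightarrow> {..k}.
        \<theta> I \<in> carrier_vec d \<and> l2_norm (\<theta> I) \<le> 1 \<and>
        (\<forall>a\<in>A. scalar_prod a (\<theta> I) = \<delta> * (\<Sum>b<m. x a b (I b)))))"

locale block_bandit = bandit +
  fixes m k :: nat and x :: "rvec \<Rightarrow> nat \<Rightarrow> nat \<Rightarrow> real"
  assumes m: "1 \<le> m" and k: "2 \<le> k" and features: "block_features d m k A x"
begin

section \<open>The uniform prior on the good arms\<close>

abbreviation \<Omega> :: "(nat \<Rightarrow> nat) set" where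
  "\<Omega> \<equiv> PiE {..<m} (\<lambda>_. {..<k})"

lemma finite_\<Omega>: "finite \<Omega>" and card_\<Omega>: "card \<Omega> = k ^ m" and \<Omega>_nonempty: "\<Omega> \<noteq> {}"
  using k by (auto simp: finite_PiE card_PiE PiE_eq_empty_iff lessThan_empty_iff)

lemma x_top: "a \<in> A \<Longrightarrow> b < m \<Longrightarrow> x a b k = 0"
  and x_le: "a \<in> A \<Longrightarrow> b < m \<Longrightarrow> i < k \<Longrightarrow> \<bar>x a b i\<bar> \<le> 1"
  and x_sum: "a \<in> A \<Longrightarrow> b < m \<Longrightarrow> (\<Sum>i<k. x a b i) \<le> real k / 2"
  and x_sq: "a \<in> A \<Longrightarrow> b < m \<Longrightarrow> (\<Sum>i<k. (x a b i)\<^sup>2) \<le> 2"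
  and x_opt: "I \<in> {..<m} \<rightarrow> {..<k} \<Longrightarrow> \<exists>a\<in>A. \<forall>b<m. x a b (I b) = 1"
  using features by (simp_all add: block_features_def)

lemma \<Omega>_app: "I \<in> \<Omega> \<Longrightarrow> b < m \<Longrightarrow> I b < k"
  by auto

lemma obtain_params:
  assumes "0 < \<delta>" "real m * \<delta> \<le> 1"
  obtains \<theta> where "\<And>I. I \<in> {..<m} \<rightarrow> {..k} \<Longrightarrow> \<theta> I \<in> carrier_vec d"
    "\<And>I. I \<in> {..<m} \<rightarrow> {..k} \<Longrightarrow> l2_norm (\<theta> I) \<le> 1"
    "\<And>I a. I \<in> {..<m} \<rightarrow> {..k} \<Longrightarrow> a \<in> A \<Longrightarrow> scalar_prod a (\<theta> I) = \<delta> * (\<Sum>b<m. x a b (I b))"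
proof -
  have "\<forall>\<delta>>0. real m * \<delta> \<le> 1 \<longrightarrow> (\<exists>\<theta>. \<forall>I\<in>{..<m} \<rightarrow> {..k}.
      \<theta> I \<in> carrier_vec d \<and> l2_norm (\<theta> I) \<le> 1 \<and>
      (\<forall>a\<in>A. scalar_prod a (\<theta> I) = \<delta> * (\<Sum>b<m. x a b (I b))))"
    using features by (simp add: block_features_def)
  with assms obtain \<theta> where "\<forall>I\<in>{..<m} \<rightarrow> {..k}. \<theta> I \<in> carrier_vec d \<and> l2_norm (\<theta> I) \<le> 1 \<and>
      (\<forall>a\<in>A. scalar_prod a (\<theta> I) = \<delta> * (\<Sum>b<m. x a b (I b)))"
    by blast
  then show ?thesis by (intro that) auto
qed

lemma \<Omega>_Pi: "I \<in> \<Omega> \<Longrightarrow> I \<in> {..<m} \<rightarrow> {..k}"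
  by (force simp: PiE_iff Pi_iff)

lemma best_value:
  assumes "I \<in> \<Omega>" "0 < \<delta>" "\<And>a. a \<in> A \<Longrightarrow> scalar_prod a \<theta> = \<delta> * (\<Sum>b<m. x a b (I b))"
  shows "\<delta> * real m \<le> scalar_prod (best_action A \<theta>) \<theta>"
proof -
  have "I \<in> {..<m} \<rightarrow> {..<k}" using assms(1) by auto
  then obtain a where a: "a \<in> A" "\<And>b. b < m \<Longrightarrow> x a b (I b) = 1" using x_opt by blast
  then have "scalar_prod a \<theta> = \<delta> * real m" using assms by simp
  with best_action(2)[OF a(1), of \<theta>] show ?thesis by simp
qed

text \<open>Second-order expansion of the exponential moment of a block with uniform good arm. The
  features average to at most 1/2, contributing \<open>u / 2\<close>. Their squares sum to at most
  2, and as \<open>k = exp (4 * u)\<close> the quadratic part contributes at most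
  \<open>u / 6\<close>. The rate 2/3 stays below the rate 1 of the optimal action.\<close>

lemma block_mgf:
  assumes a: "a \<in> A" and b: "b < m" and u: "u = ln (real k) / 4"
  shows "(\<Sum>i<k. exp (u * x a b i)) \<le> real k * exp (2 / 3 * u)"
proof -
  have k0: "real k > 1" using k by simp
  have u0: "u > 0" using k0 by (simp add: u)
  have ku: "real k = exp (4 * u)" using k0 by (simp add: u)
  have "(\<Sum>i<k. exp (u * x a b i)) \<le> (\<Sum>i<k. 1 + u * x a b i + u\<^sup>2 * exp u / 2 * (x a b i)\<^sup>2)"
  proof (rule sum_mono)
    fix i assume "i \<in> {..<k}"
    then have "\<bar>u * x a b i\<bar> \<le> u"
      using x_le[OF a b, of i] u0 by (simp add: abs_mult mult_left_le)
    from exp_le_quadratic[OF this]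
    show "exp (u * x a b i) \<le> 1 + u * x a b i + u\<^sup>2 * exp u / 2 * (x a b i)\<^sup>2"
      by (simp add: power_mult_distrib algebra_simps)
  qed
  also have "\<dots> = real k + u * (\<Sum>i<k. x a b i) + u\<^sup>2 * exp u / 2 * (\<Sum>i<k. (x a b i)\<^sup>2)"
    by (simp only: sum.distrib sum_distrib_left) simp
  also have "\<dots> \<le> real k + u * (real k / 2) + u\<^sup>2 * exp u / 2 * 2"
    using u0 x_sum[OF a b] x_sq[OF a b] by (intro add_mono mult_left_mono) auto
  also have "u\<^sup>2 * exp u / 2 * 2 = real k * u * (u * exp (- (3 * u)))"
    by (simp add: ku power2_eq_square flip: exp_add)
  also have "real k + u * (real k / 2) + real k * u * (u * exp (- (3 * u))) \<le>
      real k + u * (real k / 2) + real k * u * (1 / 6)"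
    using u0 k0 by (intro add_left_mono mult_left_mono mult_exp_neg_le) auto
  also have "\<dots> = real k * (1 + 2 / 3 * u)"
    by (simp add: algebra_simps)
  also have "\<dots> \<le> real k * exp (2 / 3 * u)"
    by (intro mult_left_mono exp_ge_add_one_self) auto
  finally show ?thesis .
qed

text \<open>For a fixed seed, at most \<open>2 ^ M\<close> different actions can be played at a given time of batch \<open>M\<close>;
  the bound is a maximal inequality over these.\<close>

lemma few_bits_bound:
  assumes t: "t < T" and M: "real (t div B) \<le> real m * ln (real k) / 24"
  shows "(\<Sum>I\<in>\<Omega>. \<Sum>b<m. x (action_at L B (\<theta> I) u \<xi> t) b (I b)) \<le> real (card \<Omega>) * (5 / 6 * real m)"
proof -
  define q where "q = t div B"
  define H where "H = {h :: bool list. length h = q}"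
  define s where "s = ln (real k) / 4"
  \<comment> \<open>Chosen to bound the prior average of the sum of \<open>exp (s * z h I)\<close>
    over all histories \<open>h\<close>.\<close>
  define c where "c = 2 ^ q * exp (2 / 3 * s) ^ m"
  define y where "y I = (\<Sum>b<m. x (action_at L B (\<theta> I) u \<xi> t) b (I b))" for I
  define z where "z h I = (\<Sum>b<m. x (play L u h t) b (I b))" for h I
  have k0: "real k > 1" using k by simp
  have s0: "s > 0" using k0 by (simp add: s_def)
  have c0: "c > 0" by (simp add: c_def)
  have Heq: "H = {h. set h \<subseteq> (UNIV :: bool set) \<and> length h = q}" by (auto simp: H_def)
  have H: "finite H" "card H = 2 ^ q"
    unfolding Heq by (rule finite_lists_length_eq, simp, subst card_lists_length_eq) auto
  have hA: "play L u h t \<in> A" if "h \<in> H" for h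
    using that t by (auto simp: H_def q_def play_in)
  \<comment> \<open>The tangent bound on \<open>ln\<close> at \<open>c\<close> takes the place of
    Jensen's inequality. The actual history depends on \<open>I\<close>, but it is one of the
    \<open>h\<close> in \<open>H\<close>, whose actions do not.\<close>
  have 1: "s * y I \<le> (\<Sum>h\<in>H. exp (s * z h I)) / c + (ln c - 1)" for I
  proof -
    have "ln (exp (s * y I) / c) \<le> exp (s * y I) / c - 1"
      using c0 by (intro ln_le_minus_one) simp
    then have "s * y I \<le> exp (s * y I) / c + (ln c - 1)"
      using c0 by (simp add: ln_div)
    moreover have "exp (s * y I) \<le> (\<Sum>h\<in>H. exp (s * z h I))"
    proof -
      have "y I = z (feedback L B (\<theta> I) u \<xi> q) I"
        by (simp add: y_def z_def action_at_def q_def)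
      moreover have "feedback L B (\<theta> I) u \<xi> q \<in> H" by (simp add: H_def)
      ultimately show ?thesis using H(1) by (auto intro: member_le_sum)
    qed
    ultimately show ?thesis using c0 by (meson add_right_mono divide_right_mono less_imp_le order_trans)
  qed
  have 2: "(\<Sum>I\<in>\<Omega>. exp (s * z h I)) \<le> real k ^ m * exp (2 / 3 * s) ^ m" if h: "h \<in> H" for h
  proof -
    have "(\<Sum>I\<in>\<Omega>. exp (s * z h I)) = (\<Sum>I\<in>\<Omega>. \<Prod>b<m. exp (s * x (play L u h t) b (I b)))"
      by (simp add: z_def sum_distrib_left exp_sum)
    \<comment> \<open>For a fixed history the action is fixed and the good arms are independent over
      the blocks, so the average factorizes.\<close>
    also have "\<dots> = (\<Prod>b<m. \<Sum>i<k. exp (s * x (play L u h t) b i))"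
      by (rule prod_sum_PiE[symmetric]) auto
    also have "\<dots> \<le> (\<Prod>b<m. real k * exp (2 / 3 * s))"
      by (intro prod_mono conjI sum_nonneg block_mgf hA[OF h] s_def) auto
    finally show ?thesis by (simp add: power_mult_distrib)
  qed
  have "s * (\<Sum>I\<in>\<Omega>. y I) \<le> (\<Sum>I\<in>\<Omega>. (\<Sum>h\<in>H. exp (s * z h I)) / c + (ln c - 1))"
    unfolding sum_distrib_left by (rule sum_mono) (rule 1)
  also have "\<dots> = (\<Sum>h\<in>H. \<Sum>I\<in>\<Omega>. exp (s * z h I)) / c + real (card \<Omega>) * (ln c - 1)"
    by (simp add: sum.distrib sum.swap[of _ _ H] flip: sum_divide_distrib)
  also have "\<dots> \<le> (\<Sum>h\<in>H. real k ^ m * exp (2 / 3 * s) ^ m) / c + real (card \<Omega>) * (ln c - 1)"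
    using c0 2 by (intro add_right_mono divide_right_mono sum_mono) auto
  also have "(\<Sum>h\<in>H. real k ^ m * exp (2 / 3 * s) ^ m) / c = real (card \<Omega>)"
    using c0 by (simp add: H c_def card_\<Omega>)
  finally have "s * (\<Sum>I\<in>\<Omega>. y I) \<le> real (card \<Omega>) * ln c" by (simp add: algebra_simps)
  \<comment> \<open>The hypothesis on the batch number says that \<open>q\<close> is at most
    \<open>m * s / 6\<close>; together with 2/3 from \<open>block_mgf\<close> this makes
    5/6.\<close>
  also have "ln c \<le> s * (5 / 6 * real m)"
  proof -
    have "ln c = real q * ln 2 + real m * (2 / 3 * s)"
      by (simp add: c_def ln_mult ln_realpow)
    moreover have "real q * ln 2 \<le> real q * 1"
      by (intro mult_left_mono) (use ln_le_minus_one[of "2::real"] in auto)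
    moreover have "real q \<le> real m * s / 6" using M by (simp add: q_def s_def)
    ultimately show ?thesis by (simp add: algebra_simps)
  qed
  finally have "s * (\<Sum>I\<in>\<Omega>. y I) \<le> real (card \<Omega>) * (s * (5 / 6 * real m))"
    by (simp add: mult_left_mono)
  then have "s * (\<Sum>I\<in>\<Omega>. y I) \<le> s * (real (card \<Omega>) * (5 / 6 * real m))"
    by (simp only: mult.left_commute)
  then show ?thesis using s0 unfolding y_def by simp
qed

lemma card_initial_times: "min (real T) z \<le> real (card {t. t < T \<and> real t < z})"
proof -
  have "{..<min T (nat \<lceil>z\<rceil>)} \<subseteq> {t. t < T \<and> real t < z}"
    by (auto simp: less_ceiling_iff zless_nat_eq_int_zless)
  from card_mono[OF _ this] have "min T (nat \<lceil>z\<rceil>) \<le> card {t. t < T \<and> real t < z}"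
    by simp
  moreover have "min (real T) z \<le> real (min T (nat \<lceil>z\<rceil>))"
    by (auto simp: min_def) linarith+
  ultimately show ?thesis by linarith
qed

lemma sum_regret_eq:
  assumes "\<And>I. I \<in> \<Omega> \<Longrightarrow> \<theta> I \<in> carrier_vec d"
  shows "(\<Sum>I\<in>\<Omega>. regret L T B A (\<theta> I) u \<xi>) = (\<Sum>t<T. \<Sum>I\<in>\<Omega>.
    scalar_prod (best_action A (\<theta> I)) (\<theta> I) - scalar_prod (action_at L B (\<theta> I) u \<xi> t) (\<theta> I))"
  by (subst sum.swap) (simp add: regret_eq assms)

text \<open>With the largest admissible signal \<open>1 / m\<close> the optimum earns 1, and by
  \<open>few_bits_bound\<close> the learner earns at most 5/6 on average over the prior at every
  early time. This holds for each noise sequence, hence for any noise law.\<close>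

lemma worst_case_regret_ge_bits:
  assumes \<nu>: "prob_space \<nu>" "sets \<nu> = sets borel"
  shows "min (real T) (real B * (real m * ln (real k) / 24)) / 6 \<le> worst_case_regret \<nu> L d T B A"
proof -
  define \<delta> where "\<delta> = 1 / real m"
  define z where "z = real B * (real m * ln (real k) / 24)"
  have \<delta>: "0 < \<delta>" "real m * \<delta> \<le> 1" "\<delta> * real m = 1" using m by (auto simp: \<delta>_def)
  obtain \<theta> where \<theta>: "\<And>I. I \<in> {..<m} \<rightarrow> {..k} \<Longrightarrow> \<theta> I \<in> carrier_vec d"
    "\<And>I. I \<in> {..<m} \<rightarrow> {..k} \<Longrightarrow> l2_norm (\<theta> I) \<le> 1"
    "\<And>I a. I \<in> {..<m} \<rightarrow> {..k} \<Longrightarrow> a \<in> A \<Longrightarrow> scalar_prod a (\<theta> I) = \<delta> * (\<Sum>b<m. x a b (I b))"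
    using obtain_params[OF \<delta>(1,2)] by blast
  interpret N: prob_space "iid \<nu> T" by (rule prob_space_iid) fact
  let ?S = "{t. t < T \<and> real t < z}"
  have pt: "real (card \<Omega>) * (min (real T) z / 6) \<le> (\<Sum>I\<in>\<Omega>. regret L T B A (\<theta> I) u \<xi>)" for u \<xi>
  proof -
    define g where "g t = (\<Sum>I\<in>\<Omega>. scalar_prod (best_action A (\<theta> I)) (\<theta> I) -
      scalar_prod (action_at L B (\<theta> I) u \<xi> t) (\<theta> I))" for t
    have g0: "0 \<le> g t" if "t < T" for t
      unfolding g_def by (intro sum_nonneg) (simp add: best_action action_at_in that)
    have g1: "real (card \<Omega>) / 6 \<le> g t" if "t \<in> ?S" for t
    proof -
      have t: "t < T" "real t < z" using that by auto
      have "real (t div B) \<le> real t / real B" by (rule of_nat_div_le_of_nat)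
      also have "\<dots> \<le> z / real B" using t B by (intro divide_right_mono) auto
      also have "\<dots> = real m * ln (real k) / 24" using B by (simp add: z_def)
      finally have *: "(\<Sum>I\<in>\<Omega>. \<Sum>b<m. x (action_at L B (\<theta> I) u \<xi> t) b (I b)) \<le> real (card \<Omega>) * (5 / 6 * real m)"
        by (rule few_bits_bound[OF t(1)])
      have "real (card \<Omega>) / 6 = real (card \<Omega>) * (\<delta> * real m) - \<delta> * (real (card \<Omega>) * (5 / 6 * real m))"
        using m by (simp add: \<delta>_def field_simps)
      also have "\<dots> \<le> real (card \<Omega>) * (\<delta> * real m) - \<delta> * (\<Sum>I\<in>\<Omega>. \<Sum>b<m. x (action_at L B (\<theta> I) u \<xi> t) b (I b))"
        using * \<delta>(1) by (intro diff_left_mono mult_left_mono) auto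
      also have "\<dots> = (\<Sum>I\<in>\<Omega>. \<delta> * real m - scalar_prod (action_at L B (\<theta> I) u \<xi> t) (\<theta> I))"
        by (simp add: sum_subtractf sum_distrib_left \<theta>(3)[OF \<Omega>_Pi action_at_in[OF t(1)]])
      also have "\<dots> \<le> g t"
        unfolding g_def by (intro sum_mono diff_right_mono best_value[OF _ \<delta>(1) \<theta>(3)[OF \<Omega>_Pi]])
      finally show ?thesis .
    qed
    have "real (card \<Omega>) * (min (real T) z / 6) \<le> real (card ?S) * (real (card \<Omega>) / 6)"
      using mult_left_mono[OF card_initial_times[of z], of "real (card \<Omega>) / 6"] by (simp add: mult.commute)
    also have "\<dots> = (\<Sum>t\<in>?S. real (card \<Omega>) / 6)" by simp
    also have "\<dots> \<le> (\<Sum>t\<in>?S. g t)" by (intro sum_mono g1)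
    also have "\<dots> \<le> (\<Sum>t<T. g t)" by (intro sum_mono2 g0) auto
    also have "\<dots> = (\<Sum>I\<in>\<Omega>. regret L T B A (\<theta> I) u \<xi>)"
      unfolding g_def by (rule sum_regret_eq[symmetric]) (simp add: \<theta> \<Omega>_Pi)
    finally show ?thesis .
  qed
  show ?thesis
    unfolding z_def[symmetric]
  proof (rule worst_case_regret_ge[OF \<nu> finite_\<Omega> \<Omega>_nonempty])
    show "real (card \<Omega>) * (min (real T) z / 6) \<le> (\<integral>\<xi>. (\<Sum>I\<in>\<Omega>. regret L T B A (\<theta> I) u \<xi>) \<partial>iid \<nu> T)" for u
      by (intro N.integral_ge_const AE_I2 pt Bochner_Integration.integrable_sum integrable_regret \<nu> \<theta> \<Omega>_Pi)
  qed (simp add: \<theta> \<Omega>_Pi)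
qed

end

section \<open>The bound from little information\<close>

context block_bandit
begin

text \<open>The two parameters differ in block \<open>b\<close> only, where the index
  \<open>k\<close> carries no signal, so only that block contributes to the drift.\<close>

lemma gap_shift_block:
  assumes \<theta>: "\<And>I a. I \<in> {..<m} \<rightarrow> {..k} \<Longrightarrow> a \<in> A \<Longrightarrow> scalar_prod a (\<theta> I) = \<delta> * (\<Sum>b<m. x a b (I b))"
    and I: "I \<in> \<Omega>" and b: "b < m" and t: "t < T"
  shows "gap_shift (\<theta> I) (\<theta> (I(b := k))) u t \<xi> =
    \<delta> * x (action_at L B (\<theta> (I(b := k))) u \<xi> t) b (I b)"
proof -
  let ?a = "action_at L B (\<theta> (I(b := k))) u \<xi> t"
  have a: "?a \<in> A" by (rule action_at_in[OF t])
  have J: "I(b := k) \<in> {..<m} \<rightarrow> {..k}" using \<Omega>_Pi[OF I] by auto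
  have "(\<Sum>c<m. x ?a c (I c)) = x ?a b (I b) + (\<Sum>c\<in>{..<m} - {b}. x ?a c (I c))"
    using b by (simp add: sum.remove)
  moreover have "(\<Sum>c<m. x ?a c ((I(b := k)) c)) = x ?a b k + (\<Sum>c\<in>{..<m} - {b}. x ?a c (I c))"
    using b by (subst sum.remove[of _ b]) (auto intro!: sum.cong)
  ultimately show ?thesis
    unfolding gap_shift_def \<theta>[OF \<Omega>_Pi[OF I] a] \<theta>[OF J a] using x_top[OF a b]
    by (simp add: algebra_simps)
qed

lemma feature_measurable:
  "t < T \<Longrightarrow> (\<lambda>\<xi>. x (action_at L B \<theta> u \<xi> t) b i) \<in> borel_measurable (\<Pi>\<^sub>M s\<in>{..<T}. borel)"
  by (rule measurable_compose[OF action_at_measurable']) simp_all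

lemma integrable_feature:
  assumes \<sigma>: "0 < \<sigma>" and t: "t < T" and b: "b < m" and i: "i < k"
  shows "integrable (iid (gaussian \<sigma>) T) (\<lambda>\<xi>. x (action_at L B \<theta> u \<xi> t) b i)"
    "integrable (iid (gaussian \<sigma>) T) (\<lambda>\<xi>. (x (action_at L B \<theta> u \<xi> t) b i)\<^sup>2)"
proof -
  interpret prob_space "iid (gaussian \<sigma>) T" by (intro prob_space_iid prob_space_gaussian \<sigma>)
  note [measurable] = feature_measurable[OF t]
  have 1: "\<bar>x (action_at L B \<theta> u \<xi> t) b i\<bar> \<le> 1" for \<xi>
    by (rule x_le[OF action_at_in[OF t] b i])
  show "integrable (iid (gaussian \<sigma>) T) (\<lambda>\<xi>. x (action_at L B \<theta> u \<xi> t) b i)"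
    by (rule integrable_const_bound[where B = 1]) (use 1 in auto)
  show "integrable (iid (gaussian \<sigma>) T) (\<lambda>\<xi>. (x (action_at L B \<theta> u \<xi> t) b i)\<^sup>2)"
    by (rule integrable_const_bound[where B = 1]) (use 1 in \<open>auto simp: abs_square_le_1\<close>)
qed

text \<open>On average over the good arm of block \<open>b\<close>, the block earns little when its signal is switched
  off, and few observations are made of the good arm, so switching the signal on changes little.\<close>

lemma little_information_bound:
  assumes \<sigma>: "0 < \<sigma>" and \<delta>: "0 < \<delta>" and small: "\<delta>\<^sup>2 * real T \<le> \<sigma>\<^sup>2 * real k / 128"
    and \<theta>: "\<And>I a. I \<in> {..<m} \<rightarrow> {..k} \<Longrightarrow> a \<in> A \<Longrightarrow> scalar_prod a (\<theta> I) = \<delta> * (\<Sum>b<m. x a b (I b))"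
    and b: "b < m" and t: "t < T"
  shows "(\<Sum>I\<in>\<Omega>. \<integral>\<xi>. x (action_at L B (\<theta> I) u \<xi> t) b (I b) \<partial>iid (gaussian \<sigma>) T) \<le> real (card \<Omega>) * (3 / 4)"
proof -
  let ?P = "iid (gaussian \<sigma>) T"
  interpret prob_space ?P by (intro prob_space_iid prob_space_gaussian \<sigma>)
  define y where "y J s i \<xi> = x (action_at L B (\<theta> J) u \<xi> s) b i" for J s i \<xi>
  \<comment> \<open>The bound of \<open>integral_drift_le\<close> in the environment
    \<open>J\<close> whose block \<open>b\<close> is switched off, for the candidate arm
    \<open>i\<close>.\<close>
  define F where "F J i = (\<integral>\<xi>. y J t i \<xi> \<partial>?P) + 1 / 16 +
    8 / \<sigma>\<^sup>2 * (\<integral>\<xi>. (\<Sum>s<T. \<delta>\<^sup>2 * (y J s i \<xi>)\<^sup>2) \<partial>?P)" for J i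
  have int: "integrable ?P (y J s i)" "integrable ?P (\<lambda>\<xi>. (y J s i \<xi>)\<^sup>2)" if "s < T" "i < k" for J s i
    unfolding y_def using integrable_feature[OF \<sigma> that(1) b that(2)] by auto
  have 1: "(\<integral>\<xi>. y I t (I b) \<xi> \<partial>?P) \<le> F (I(b := k)) (I b)" if I: "I \<in> \<Omega>" for I
  proof -
    let ?J = "I(b := k)" and ?g = "gap_shift (\<theta> I) (\<theta> (I(b := k))) u"
    have Ib: "I b < k" using \<Omega>_app[OF I b] .
    have g: "?g s \<xi> = \<delta> * y ?J s (I b) \<xi>" if "s < T" for s \<xi>
      unfolding y_def by (rule gap_shift_block[OF \<theta> I b that])
    have yle: "\<bar>y ?J s (I b) \<xi>\<bar> \<le> 1" if "s < T" for s \<xi>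
      unfolding y_def by (rule x_le[OF action_at_in[OF that] b Ib])
    have "(\<integral>\<xi>. y ?J t (I b) (drift ?g \<xi> T) \<partial>?P) \<le> (\<integral>\<xi>. y ?J t (I b) \<xi> \<partial>?P) + 1 / 16
        + 8 / \<sigma>\<^sup>2 * (\<integral>\<xi>. (\<Sum>s<T. (?g s \<xi>)\<^sup>2) \<partial>?P)"
    proof (rule integral_drift_le[OF \<sigma> predictable_gap_shift])
      show "\<bar>?g s \<xi>\<bar> \<le> \<delta>" if "s < T" for s \<xi>
        using yle[OF that, of \<xi>] \<delta> by (simp add: g[OF that] abs_mult mult_left_le)
      show "y ?J t (I b) \<in> borel_measurable (\<Pi>\<^sub>M s\<in>{..<T}. borel)"
        unfolding y_def by (rule feature_measurable[OF t])
    qed (rule yle[OF t])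
    also have "(\<lambda>\<xi>. y ?J t (I b) (drift ?g \<xi> T)) = y I t (I b)"
      by (simp add: y_def fun_eq_iff action_at_drift[OF t, of "\<theta> I" u _ "\<theta> ?J"])
    also have "(\<lambda>\<xi>. \<Sum>s<T. (?g s \<xi>)\<^sup>2) = (\<lambda>\<xi>. \<Sum>s<T. \<delta>\<^sup>2 * (y ?J s (I b) \<xi>)\<^sup>2)"
      by (simp add: g power_mult_distrib)
    finally show ?thesis unfolding F_def .
  qed
  \<comment> \<open>The run under \<open>J\<close> does not know \<open>i\<close>, so the feature
    bounds can be summed over all arms inside one expectation.\<close>
  have 2: "(\<Sum>i<k. F J i) \<le> real k * (3 / 4)" for J
  proof -
    have "(\<Sum>i<k. \<integral>\<xi>. y J t i \<xi> \<partial>?P) = (\<integral>\<xi>. (\<Sum>i<k. y J t i \<xi>) \<partial>?P)"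
      by (rule Bochner_Integration.integral_sum[symmetric]) (use int t in auto)
    also have "\<dots> \<le> real k / 2"
    proof (rule integral_le_const)
      show "integrable ?P (\<lambda>\<xi>. \<Sum>i<k. y J t i \<xi>)"
        using int(1)[OF t] by (intro Bochner_Integration.integrable_sum) auto
      show "AE \<xi> in ?P. (\<Sum>i<k. y J t i \<xi>) \<le> real k / 2"
        unfolding y_def by (intro AE_I2 x_sum action_at_in t b)
    qed
    finally have a: "(\<Sum>i<k. \<integral>\<xi>. y J t i \<xi> \<partial>?P) \<le> real k / 2" .
    have "(\<Sum>i<k. \<integral>\<xi>. (\<Sum>s<T. \<delta>\<^sup>2 * (y J s i \<xi>)\<^sup>2) \<partial>?P) =
        (\<integral>\<xi>. (\<Sum>i<k. \<Sum>s<T. \<delta>\<^sup>2 * (y J s i \<xi>)\<^sup>2) \<partial>?P)"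
      by (rule Bochner_Integration.integral_sum[symmetric]) (use int in auto)
    also have "\<dots> \<le> \<delta>\<^sup>2 * (real T * 2)"
    proof (rule integral_le_const)
      have "(\<Sum>i<k. \<Sum>s<T. \<delta>\<^sup>2 * (y J s i \<xi>)\<^sup>2) \<le> \<delta>\<^sup>2 * (real T * 2)" for \<xi>
      proof -
        have "(\<Sum>i<k. \<Sum>s<T. \<delta>\<^sup>2 * (y J s i \<xi>)\<^sup>2) = \<delta>\<^sup>2 * (\<Sum>s<T. \<Sum>i<k. (y J s i \<xi>)\<^sup>2)"
          by (subst sum.swap) (simp add: sum_distrib_left)
        also have "\<dots> \<le> \<delta>\<^sup>2 * (\<Sum>s<T. 2)"
          by (intro mult_left_mono sum_mono) (auto simp: y_def intro!: x_sq action_at_in b)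
        finally show ?thesis by simp
      qed
      then show "AE \<xi> in ?P. (\<Sum>i<k. \<Sum>s<T. \<delta>\<^sup>2 * (y J s i \<xi>)\<^sup>2) \<le> \<delta>\<^sup>2 * (real T * 2)" by simp
      show "integrable ?P (\<lambda>\<xi>. \<Sum>i<k. \<Sum>s<T. \<delta>\<^sup>2 * (y J s i \<xi>)\<^sup>2)"
        using int(2) by (intro Bochner_Integration.integrable_sum Bochner_Integration.integrable_mult_right) auto
    qed
    finally have c: "(\<Sum>i<k. \<integral>\<xi>. (\<Sum>s<T. \<delta>\<^sup>2 * (y J s i \<xi>)\<^sup>2) \<partial>?P) \<le> \<delta>\<^sup>2 * real T * 2" by simp
    have "(\<Sum>i<k. F J i) = (\<Sum>i<k. \<integral>\<xi>. y J t i \<xi> \<partial>?P) + real k / 16 +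
        8 / \<sigma>\<^sup>2 * (\<Sum>i<k. \<integral>\<xi>. (\<Sum>s<T. \<delta>\<^sup>2 * (y J s i \<xi>)\<^sup>2) \<partial>?P)"
      by (simp add: F_def sum.distrib sum_distrib_left)
    \<comment> \<open>Per arm this is 1/2 + 1/16 + 1/8 = 11/16, below 3/4; the last summand comes
      from the smallness of the signal.\<close>
    also have "\<dots> \<le> real k / 2 + real k / 16 + 8 / \<sigma>\<^sup>2 * (\<sigma>\<^sup>2 * real k / 128 * 2)"
    proof (intro add_mono mult_left_mono a)
      show "(\<Sum>i<k. \<integral>\<xi>. (\<Sum>s<T. \<delta>\<^sup>2 * (y J s i \<xi>)\<^sup>2) \<partial>?P) \<le> \<sigma>\<^sup>2 * real k / 128 * 2"
        using c small by linarith
    qed auto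
    also have "\<dots> \<le> real k * (3 / 4)" using \<sigma> by simp
    finally show ?thesis .
  qed
  \<comment> \<open>Redrawing the good arm of block \<open>b\<close> changes \<open>I b\<close> but
    not \<open>I(b := k)\<close>, which is what allows the sum over arms with a fixed reference
    environment.\<close>
  have "real k * (\<Sum>I\<in>\<Omega>. F (I(b := k)) (I b)) = (\<Sum>I\<in>\<Omega>. \<Sum>i<k. F (I(b := k)) i)"
    using sum_PiE_resample[where b = b and S = "{..<m}" and K = "{..<k}" and f = "\<lambda>I. F (I(b := k)) (I b)"] b by simp
  also have "\<dots> \<le> (\<Sum>I\<in>\<Omega>. real k * (3 / 4))" by (intro sum_mono 2)
  finally have "(\<Sum>I\<in>\<Omega>. F (I(b := k)) (I b)) \<le> real (card \<Omega>) * (3 / 4)"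
    using k by simp
  with sum_mono[OF 1, of \<Omega> "\<lambda>I. I"] show ?thesis by (simp add: y_def)
qed

text \<open>On average over the prior each block earns at most 3/4 of its optimum at every time, a
  loss of \<open>\<delta> / 4\<close> per block and time.\<close>

lemma worst_case_regret_ge_information:
  assumes \<sigma>: "0 < \<sigma>" and \<delta>: "0 < \<delta>" "real m * \<delta> \<le> 1" and small: "\<delta>\<^sup>2 * real T \<le> \<sigma>\<^sup>2 * real k / 128"
  shows "\<delta> * real m * real T / 4 \<le> worst_case_regret (gaussian \<sigma>) L d T B A"
proof -
  let ?P = "iid (gaussian \<sigma>) T"
  interpret prob_space ?P by (intro prob_space_iid prob_space_gaussian \<sigma>)
  obtain \<theta> where \<theta>: "\<And>I. I \<in> {..<m} \<rightarrow> {..k} \<Longrightarrow> \<theta> I \<in> carrier_vec d"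
    "\<And>I. I \<in> {..<m} \<rightarrow> {..k} \<Longrightarrow> l2_norm (\<theta> I) \<le> 1"
    "\<And>I a. I \<in> {..<m} \<rightarrow> {..k} \<Longrightarrow> a \<in> A \<Longrightarrow> scalar_prod a (\<theta> I) = \<delta> * (\<Sum>b<m. x a b (I b))"
    using obtain_params[OF \<delta>] by blast
  show ?thesis
  proof (rule worst_case_regret_ge[OF prob_space_gaussian[OF \<sigma>] sets_gaussian finite_\<Omega> \<Omega>_nonempty])
    fix u
    define y where "y I t b \<xi> = x (action_at L B (\<theta> I) u \<xi> t) b (I b)" for I t b \<xi>
    have int: "integrable ?P (y I t b)" if "I \<in> \<Omega>" "t < T" "b < m" for I t b
      unfolding y_def by (rule integrable_feature[OF \<sigma> that(2,3) \<Omega>_app[OF that(1,3)]])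
    have ii: "integrable ?P (\<lambda>\<xi>. \<delta> * real m - \<delta> * (\<Sum>b<m. y I t b \<xi>))" if "I \<in> \<Omega>" "t < T" for I t
      using int[OF that]
      by (intro Bochner_Integration.integrable_diff Bochner_Integration.integrable_mult_right
          Bochner_Integration.integrable_sum) simp_all
    have "real (card \<Omega>) * (\<delta> * real m * real T / 4) =
        (\<Sum>t<T. real (card \<Omega>) * (\<delta> * real m) - \<delta> * (\<Sum>b<m. real (card \<Omega>) * (3 / 4)))"
      by (simp add: field_simps)
    also have "\<dots> \<le> (\<Sum>t<T. real (card \<Omega>) * (\<delta> * real m) - \<delta> * (\<Sum>b<m. \<Sum>I\<in>\<Omega>. \<integral>\<xi>. y I t b \<xi> \<partial>?P))"
      unfolding y_def using \<delta>
      by (intro sum_mono diff_left_mono mult_left_mono little_information_bound[OF \<sigma> \<delta>(1) small \<theta>(3)]) auto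
    also have "\<dots> = (\<Sum>t<T. \<Sum>I\<in>\<Omega>. \<delta> * real m - \<delta> * (\<Sum>b<m. \<integral>\<xi>. y I t b \<xi> \<partial>?P))"
      by (intro sum.cong refl) (simp add: sum_subtractf sum.swap[of _ "{..<m}"] flip: sum_distrib_left)
    also have "\<dots> = (\<Sum>t<T. \<Sum>I\<in>\<Omega>. \<integral>\<xi>. \<delta> * real m - \<delta> * (\<Sum>b<m. y I t b \<xi>) \<partial>?P)"
    proof (intro sum.cong refl)
      fix t I assume "t \<in> {..<T}" "I \<in> \<Omega>"
      then have i: "integrable ?P (y I t b)" if "b < m" for b using int that by auto
      then have "integrable ?P (\<lambda>\<xi>. \<Sum>b<m. y I t b \<xi>)" by (intro Bochner_Integration.integrable_sum) auto
      then show "\<delta> * real m - \<delta> * (\<Sum>b<m. \<integral>\<xi>. y I t b \<xi> \<partial>?P) =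
          (\<integral>\<xi>. \<delta> * real m - \<delta> * (\<Sum>b<m. y I t b \<xi>) \<partial>?P)"
        using i by (simp add: Bochner_Integration.integral_sum prob_space)
    qed
    also have "\<dots> = (\<integral>\<xi>. (\<Sum>t<T. \<Sum>I\<in>\<Omega>. \<delta> * real m - \<delta> * (\<Sum>b<m. y I t b \<xi>)) \<partial>?P)"
    proof (subst Bochner_Integration.integral_sum)
      show "integrable ?P (\<lambda>\<xi>. \<Sum>I\<in>\<Omega>. \<delta> * real m - \<delta> * (\<Sum>b<m. y I t b \<xi>))" if "t \<in> {..<T}" for t
        using that by (intro Bochner_Integration.integrable_sum ii) auto
      show "(\<Sum>t<T. \<Sum>I\<in>\<Omega>. \<integral>\<xi>. \<delta> * real m - \<delta> * (\<Sum>b<m. y I t b \<xi>) \<partial>?P) =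
          (\<Sum>t<T. \<integral>\<xi>. (\<Sum>I\<in>\<Omega>. \<delta> * real m - \<delta> * (\<Sum>b<m. y I t b \<xi>)) \<partial>?P)"
        by (intro sum.cong refl Bochner_Integration.integral_sum[symmetric] ii) auto
    qed
    also have "\<dots> \<le> (\<integral>\<xi>. (\<Sum>I\<in>\<Omega>. regret L T B A (\<theta> I) u \<xi>) \<partial>?P)"
    proof (rule integral_mono)
      show "integrable ?P (\<lambda>\<xi>. \<Sum>t<T. \<Sum>I\<in>\<Omega>. \<delta> * real m - \<delta> * (\<Sum>b<m. y I t b \<xi>))"
        by (intro Bochner_Integration.integrable_sum ii) auto
      show "integrable ?P (\<lambda>\<xi>. \<Sum>I\<in>\<Omega>. regret L T B A (\<theta> I) u \<xi>)"
        by (intro Bochner_Integration.integrable_sum integrable_regret prob_space_gaussian \<sigma> sets_gaussian \<theta> \<Omega>_Pi)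
      show "(\<Sum>t<T. \<Sum>I\<in>\<Omega>. \<delta> * real m - \<delta> * (\<Sum>b<m. y I t b \<xi>)) \<le> (\<Sum>I\<in>\<Omega>. regret L T B A (\<theta> I) u \<xi>)" for \<xi>
      proof -
        have "\<delta> * real m - \<delta> * (\<Sum>b<m. y I t b \<xi>) \<le> scalar_prod (best_action A (\<theta> I)) (\<theta> I) -
            scalar_prod (action_at L B (\<theta> I) u \<xi> t) (\<theta> I)" if "t < T" "I \<in> \<Omega>" for t I
          unfolding y_def \<theta>(3)[OF \<Omega>_Pi[OF that(2)] action_at_in[OF that(1)], symmetric]
          by (intro diff_right_mono best_value[OF that(2) \<delta>(1) \<theta>(3)[OF \<Omega>_Pi]] that)
        then show ?thesis
          by (subst sum_regret_eq) (auto simp: \<theta> \<Omega>_Pi intro!: sum_mono)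
      qed
    qed
    finally show "real (card \<Omega>) * (\<delta> * real m * real T / 4) \<le> (\<integral>\<xi>. (\<Sum>I\<in>\<Omega>. regret L T B A (\<theta> I) u \<xi>) \<partial>?P)" .
  qed (simp add: \<theta> \<Omega>_Pi)
qed

lemma worst_case_regret_ge_sqrt:
  assumes \<sigma>: "0 < \<sigma>"
  shows "min (real T) (\<sigma> / 12 * sqrt ((real m)\<^sup>2 * real k * real T)) / 4
    \<le> worst_case_regret (gaussian \<sigma>) L d T B A"
proof -
  \<comment> \<open>The largest signal that still satisfies the information constraint. The cap
    \<open>1 / m\<close> in \<open>\<delta>\<close> comes from the norm of the parameter; where it
    is active, the regret is linear in \<open>T\<close>.\<close>
  define \<rho> where "\<rho> = \<sigma> * sqrt (real k / (128 * real T))"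
  define \<delta> where "\<delta> = min (1 / real m) \<rho>"
  have T0: "real T > 0" and m0: "real m > 0" and k0: "real k > 0" using T m k by auto
  have \<rho>0: "\<rho> > 0" using \<sigma> T0 k0 by (simp add: \<rho>_def)
  have \<delta>: "0 < \<delta>" "real m * \<delta> \<le> 1" "\<delta> \<le> \<rho>"
    using \<rho>0 m0 by (auto simp: \<delta>_def min_def field_simps)
  have "\<delta>\<^sup>2 \<le> \<rho>\<^sup>2" using \<delta> by (intro power_mono) auto
  also have "\<rho>\<^sup>2 = \<sigma>\<^sup>2 * (real k / (128 * real T))"
    using T0 k0 by (simp add: \<rho>_def power_mult_distrib)
  finally have "\<delta>\<^sup>2 * real T \<le> \<sigma>\<^sup>2 * (real k / (128 * real T)) * real T"
    using T0 by (intro mult_right_mono) auto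
  also have "\<dots> = \<sigma>\<^sup>2 * real k / 128" using T0 by simp
  finally have main: "\<delta> * real m * real T / 4 \<le> worst_case_regret (gaussian \<sigma>) L d T B A"
    by (intro worst_case_regret_ge_information \<sigma> \<delta>)
  have "\<rho> * real m * real T \<ge> \<sigma> / 12 * sqrt ((real m)\<^sup>2 * real k * real T)"
  proof -
    \<comment> \<open>Relaxes 128 to the square 144 to get a rational constant.\<close>
    have "sqrt (real k * real T / 144) \<le> sqrt (real k * real T / 128)"
      using T0 k0 by (intro real_sqrt_le_mono divide_left_mono) auto
    moreover have "sqrt (144::real) = 12" by (rule real_sqrt_unique) auto
    ultimately have 1: "sqrt (real k * real T) / 12 \<le> sqrt (real k * real T / 128)"
      by (simp add: real_sqrt_divide)
    have "sqrt (real k / (128 * real T)) * real T = sqrt (real k / (128 * real T) * (real T)\<^sup>2)"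
      using T0 by (simp only: real_sqrt_mult) simp
    also have "real k / (128 * real T) * (real T)\<^sup>2 = real k * real T / 128"
      using T0 by (simp add: power2_eq_square)
    finally have 2: "sqrt (real k / (128 * real T)) * real T = sqrt (real k * real T / 128)" .
    have "\<sigma> / 12 * sqrt ((real m)\<^sup>2 * real k * real T) = (\<sigma> * real m) * (sqrt (real k * real T) / 12)"
      using m0 by (simp add: real_sqrt_mult)
    also have "\<dots> \<le> (\<sigma> * real m) * (sqrt (real k / (128 * real T)) * real T)"
      unfolding 2 using 1 \<sigma> m0 by (intro mult_left_mono) auto
    finally show ?thesis by (simp add: \<rho>_def mult_ac)
  qed
  moreover have "\<delta> * real m * real T = min (real T) (\<rho> * real m * real T)"
    using m0 T0 by (auto simp: \<delta>_def min_def field_simps)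
  ultimately have "min (real T) (\<sigma> / 12 * sqrt ((real m)\<^sup>2 * real k * real T)) \<le> \<delta> * real m * real T"
    by (simp add: min_le_iff_disj)
  with main show ?thesis by linarith
qed

end

section \<open>Construction of hard action sets\<close>

definition hard_instance :: "nat \<Rightarrow> nat \<Rightarrow> nat \<Rightarrow> nat \<Rightarrow> rvec set \<Rightarrow> (rvec \<Rightarrow> nat \<Rightarrow> nat \<Rightarrow> real) \<Rightarrow> bool" where
  "hard_instance d K m k A x \<longleftrightarrow> action_set d A \<and> card A = K \<and> (\<forall>a\<in>A. l2_norm a \<le> 1) \<and>
     1 \<le> m \<and> 2 \<le> k \<and> block_features d m k A x"

section \<open>Spanning and filling up to the prescribed size\<close>

lemma spans_scaled_units:
  assumes A: "A \<subseteq> carrier_vec d" and c: "c \<noteq> 0" and u: "\<And>j. j < d \<Longrightarrow> c \<cdot>\<^sub>v unit_vec d j \<in> A"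
  shows "spans d A"
proof -
  interpret vec_space "TYPE(real)" d .
  have "set (unit_vecs d) \<subseteq> span A"
  proof
    fix v :: rvec assume "v \<in> set (unit_vecs d)"
    then obtain j where j: "j < d" and v: "v = unit_vec d j" by (auto simp: unit_vecs_def)
    have "c \<cdot>\<^sub>v unit_vec d j \<in> span A" by (rule subsetD[OF in_own_span[OF A] u[OF j]])
    from smult_in_span[OF A this, of "1 / c"] show "v \<in> span A"
      using c by (simp add: v smult_smult_assoc)
  qed
  from span_subsetI[OF A this] have "carrier_vec d \<subseteq> span A"
    by (simp add: span_unit_vecs_is_carrier)
  moreover have "span A \<subseteq> carrier_vec d" by (rule span_is_subset2[OF A])
  ultimately show ?thesis unfolding spans_def by blast
qed

lemma fill_up:
  assumes "finite C" "card C \<le> K" "C \<subseteq> P" "infinite P"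
  obtains A where "C \<subseteq> A" "A \<subseteq> P" "finite A" "card A = K"
proof -
  have "infinite (P - C)" using assms by simp
  then obtain F where F: "finite F" "card F = K - card C" "F \<subseteq> P - C"
    using infinite_arbitrarily_large by meson
  have "card (C \<union> F) = K" using assms F by (subst card_Un_disjoint) auto
  then show thesis using F assms by (intro that[of "C \<union> F"]) auto
qed

lemma infinite_scaled_unit:
  assumes "0 < d" "0 < c"
  shows "infinite ((\<lambda>r. r \<cdot>\<^sub>v unit_vec d 0) ` {0<..<c} :: rvec set)"
proof -
  have "inj_on (\<lambda>r. r \<cdot>\<^sub>v unit_vec d 0 :: rvec) {0<..<c}"
  proof (rule inj_onI)
    fix r s :: real assume "r \<cdot>\<^sub>v unit_vec d 0 = s \<cdot>\<^sub>v unit_vec d 0"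
    then have "vec_index (r \<cdot>\<^sub>v unit_vec d 0) 0 = vec_index (s \<cdot>\<^sub>v unit_vec d 0) 0" by simp
    then show "r = s" using assms by simp
  qed
  moreover have "infinite {0<..<c}" using assms(2) by (simp add: infinite_Ioo)
  ultimately show ?thesis by (simp add: finite_image_iff)
qed

lemma l2_norm_scaled_unit: "j < d \<Longrightarrow> l2_norm (c \<cdot>\<^sub>v unit_vec d j) = \<bar>c\<bar>"
  by (simp add: l2_norm_def)

text \<open>Coordinate \<open>b * k + i\<close> stands for arm \<open>i\<close> of block
  \<open>b\<close>. A value \<open>I b = k\<close> leaves the block zero, so the same formula yields
  actions and also parameters without signal in some blocks.\<close>

definition block_vec :: "nat \<Rightarrow> nat \<Rightarrow> nat \<Rightarrow> real \<Rightarrow> (nat \<Rightarrow> nat) \<Rightarrow> rvec" where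
  "block_vec d m k c I = Matrix.vec d (\<lambda>j. if j < m * k \<and> j mod k = I (j div k) then c else 0)"

lemma block_vec_carrier [simp]: "block_vec d m k c I \<in> carrier_vec d"
  by (simp add: block_vec_def)

lemma block_index_less:
  assumes "b < m" "i < (k::nat)"
  shows "b * k + i < m * k"
proof -
  have "b * k + i < Suc b * k" using assms(2) by simp
  also have "\<dots> \<le> m * k" using assms(1) by (intro mult_le_mono1) simp
  finally show ?thesis .
qed

lemma block_vec_index:
  assumes "m * k \<le> d" "b < m" "i < k"
  shows "vec_index (block_vec d m k c I) (b * k + i) = (if i = I b then c else 0)"
  using block_index_less[OF assms(2,3)] assms by (auto simp: block_vec_def)

lemma scalar_prod_block_vec:
  assumes a: "a \<in> carrier_vec d" and mk: "m * k \<le> d"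
  shows "scalar_prod a (block_vec d m k c I) =
    c * (\<Sum>b<m. if I b < k then vec_index a (b * k + I b) else 0)"
proof -
  let ?v = "block_vec d m k c I"
  have "scalar_prod a ?v = (\<Sum>j<d. vec_index a j * vec_index ?v j)"
    by (simp add: scalar_prod_def block_vec_def lessThan_atLeast0)
  also have "\<dots> = (\<Sum>j<m * k. vec_index a j * vec_index ?v j)"
    using mk by (intro sum.mono_neutral_right) (auto simp: block_vec_def)
  also have "\<dots> = (\<Sum>b<m. \<Sum>j = b * k..<b * k + k. vec_index a j * vec_index ?v j)"
    by (rule sum.nat_group[symmetric])
  also have "\<dots> = (\<Sum>b<m. \<Sum>i<k. vec_index a (b * k + i) * vec_index ?v (b * k + i))"
    by (rule sum.cong[OF refl], subst sum.atLeastLessThan_shift_0) (simp add: lessThan_atLeast0)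
  also have "\<dots> = (\<Sum>b<m. \<Sum>i<k. if i = I b then c * vec_index a (b * k + i) else 0)"
    by (intro sum.cong refl) (simp add: block_vec_index[OF mk])
  also have "\<dots> = (\<Sum>b<m. c * (if I b < k then vec_index a (b * k + I b) else 0))"
    by (intro sum.cong refl) (simp add: sum.delta)
  finally show ?thesis by (simp add: sum_distrib_left)
qed

lemma l2_norm_block_vec:
  assumes "m * k \<le> d" "0 \<le> c"
  shows "l2_norm (block_vec d m k c I) \<le> sqrt (real m) * c"
proof -
  have "scalar_prod (block_vec d m k c I) (block_vec d m k c I) \<le> c * (\<Sum>b<m. c)"
    unfolding scalar_prod_block_vec[OF block_vec_carrier assms(1)]
    using assms by (intro mult_left_mono sum_mono) (auto simp: block_vec_index[OF assms(1)])
  also have "\<dots> = (sqrt (real m) * c)\<^sup>2" by (simp add: power2_eq_square mult_ac)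
  finally show ?thesis
    unfolding l2_norm_def using assms(2) by (intro real_le_lsqrt) auto
qed

text \<open>A product action has squared norm \<open>1 / m\<close> in each block. Every vector
  within this limit satisfies the feature bounds, so further actions may be taken from here without
  harm.\<close>

definition block_pool :: "nat \<Rightarrow> nat \<Rightarrow> nat \<Rightarrow> rvec set" where
  "block_pool d m k = {a \<in> carrier_vec d. l2_norm a \<le> 1 \<and>
     (\<forall>b<m. (\<Sum>i<k. (vec_index a (b * k + i))\<^sup>2) \<le> 1 / real m)}"

lemma scaled_unit_in_block_pool:
  assumes m: "1 \<le> m" and mk: "m * k \<le> d" and j: "j < d" and c: "\<bar>c\<bar> \<le> 1 / sqrt (real m)"
  shows "c \<cdot>\<^sub>v unit_vec d j \<in> block_pool d m k"
proof -
  have c2: "c\<^sup>2 \<le> 1 / real m"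
    using power_mono[OF c, of 2] by (simp add: power_divide)
  have "sqrt (real m) \<ge> 1" using m by simp
  then have "1 / sqrt (real m) \<le> 1" using m by (simp add: field_simps)
  then have "l2_norm (c \<cdot>\<^sub>v unit_vec d j) \<le> 1" using c by (simp add: l2_norm_scaled_unit[OF j])
  moreover have "(\<Sum>i<k. (vec_index (c \<cdot>\<^sub>v unit_vec d j) (b * k + i))\<^sup>2) \<le> 1 / real m" if b: "b < m" for b
  proof -
    have "(\<Sum>i<k. (vec_index (c \<cdot>\<^sub>v unit_vec d j) (b * k + i))\<^sup>2) =
        (\<Sum>i<k. if b * k + i = j then c\<^sup>2 else 0)"
      using block_index_less[OF b] mk j by (intro sum.cong) (fastforce simp: unit_vec_def)+
    \<comment> \<open>At most one \<open>i\<close> hits coordinate \<open>j\<close>. If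
      \<open>j\<close> lies before the block, the truncated difference is harmless, as only an upper
      bound is needed.\<close>
    also have "\<dots> \<le> (\<Sum>i\<in>{j - b * k}. c\<^sup>2)"
      by (subst sum.inter_filter[symmetric], simp, intro sum_mono2) auto
    finally show ?thesis using c2 by simp
  qed
  ultimately show ?thesis by (simp add: block_pool_def)
qed

lemma block_vec_in_block_pool:
  assumes m: "1 \<le> m" and mk: "m * k \<le> d"
  shows "block_vec d m k (1 / sqrt (real m)) I \<in> block_pool d m k"
proof -
  let ?v = "block_vec d m k (1 / sqrt (real m)) I"
  have "l2_norm ?v \<le> 1" using l2_norm_block_vec[OF mk, of "1 / sqrt (real m)" I] m by simp
  moreover have "(\<Sum>i<k. (vec_index ?v (b * k + i))\<^sup>2) \<le> 1 / real m" if b: "b < m" for b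
  proof -
    have "(\<Sum>i<k. (vec_index ?v (b * k + i))\<^sup>2) = (\<Sum>i<k. if i = I b then 1 / real m else 0)"
      by (intro sum.cong) (auto simp: block_vec_index[OF mk b] power_divide)
    also have "\<dots> \<le> 1 / real m" by (simp add: sum.delta)
    finally show ?thesis .
  qed
  ultimately show ?thesis by (simp add: block_pool_def)
qed

text \<open>The scale \<open>sqrt m\<close> turns a selected coordinate into 1 and the limit of the
  pool into a sum of squares at most 1.\<close>

lemma block_features_product:
  assumes m: "1 \<le> m" and k: "4 \<le> k" and mk: "m * k \<le> d"
    and pool: "A \<subseteq> block_pool d m k"
    and core: "\<And>I. I \<in> PiE {..<m} (\<lambda>_. {..<k}) \<Longrightarrow> block_vec d m k (1 / sqrt (real m)) I \<in> A"
  shows "block_features d m k A (\<lambda>a b i. if i < k then sqrt (real m) * vec_index a (b * k + i) else 0)"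
    (is "block_features d m k A ?x")
  unfolding block_features_def
proof (intro conjI ballI allI impI)
  fix a b assume a: "a \<in> A" and b: "b < m"
  show "?x a b k = 0" by simp
  have "(\<Sum>i<k. (?x a b i)\<^sup>2) = real m * (\<Sum>i<k. (vec_index a (b * k + i))\<^sup>2)"
    by (simp add: power_mult_distrib sum_distrib_left)
  also have "\<dots> \<le> real m * (1 / real m)"
    using a b pool by (intro mult_left_mono) (auto simp: block_pool_def)
  also have "\<dots> = 1" using m by simp
  finally have sq: "(\<Sum>i<k. (?x a b i)\<^sup>2) \<le> 1" .
  then show "(\<Sum>i<k. (?x a b i)\<^sup>2) \<le> 2" by linarith
  show "\<bar>?x a b i\<bar> \<le> 1" if "i < k" for i
  proof -
    have "(?x a b i)\<^sup>2 \<le> (\<Sum>i<k. (?x a b i)\<^sup>2)"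
      by (rule member_le_sum) (use that in auto)
    with sq have "(?x a b i)\<^sup>2 \<le> 1" by linarith
    then show ?thesis by (simp add: abs_square_le_1)
  qed
  \<comment> \<open>The bound \<open>y \<le> y * y + 1 / 4\<close> gives \<open>1 + k / 4\<close>,
    which is at most \<open>k / 2\<close> exactly when \<open>k\<close> is at least 4.\<close>
  have "(\<Sum>i<k. ?x a b i) \<le> (\<Sum>i<k. (?x a b i)\<^sup>2 + 1 / 4)"
  proof (rule sum_mono)
    have "y \<le> y\<^sup>2 + 1 / 4" for y :: real
      using zero_le_power2[of "y - 1 / 2"] by (simp add: power2_eq_square algebra_simps)
    then show "?x a b i \<le> (?x a b i)\<^sup>2 + 1 / 4" for i .
  qed
  also have "\<dots> \<le> 1 + real k / 4" using sq by (simp add: sum.distrib)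
  also have "\<dots> \<le> real k / 2" using k by simp
  finally show "(\<Sum>i<k. ?x a b i) \<le> real k / 2" .
next
  fix I assume I: "I \<in> {..<m} \<rightarrow> {..<k}"
  let ?v = "block_vec d m k (1 / sqrt (real m)) (restrict I {..<m})"
  have "?v \<in> A" by (rule core) (use I in auto)
  moreover have "?x ?v b (I b) = 1" if b: "b < m" for b
  proof -
    have "I b < k" using I b by auto
    then show ?thesis using m b by (simp add: block_vec_index[OF mk b])
  qed
  ultimately show "\<exists>a\<in>A. \<forall>b<m. ?x a b (I b) = 1" by blast
next
  fix \<delta> :: real assume \<delta>: "0 < \<delta>" "real m * \<delta> \<le> 1"
  show "\<exists>\<theta>. \<forall>I\<in>{..<m} \<rightarrow> {..k}. \<theta> I \<in> carrier_vec d \<and> l2_norm (\<theta> I) \<le> 1 \<and>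
      (\<forall>a\<in>A. scalar_prod a (\<theta> I) = \<delta> * (\<Sum>b<m. ?x a b (I b)))"
  \<comment> \<open>The norm is at most \<open>sqrt m * (\<delta> * sqrt m) = m * \<delta>\<close>,
    and the inner product with an action restores the scale of the features.\<close>
  proof (intro exI[of _ "block_vec d m k (\<delta> * sqrt (real m))"] ballI conjI)
    fix I
    show "block_vec d m k (\<delta> * sqrt (real m)) I \<in> carrier_vec d" by simp
    show "l2_norm (block_vec d m k (\<delta> * sqrt (real m)) I) \<le> 1"
      using l2_norm_block_vec[OF mk, of "\<delta> * sqrt (real m)" I] \<delta> by (simp add: mult_ac)
    fix a assume "a \<in> A"
    then have "a \<in> carrier_vec d" using pool by (auto simp: block_pool_def)
    then show "scalar_prod a (block_vec d m k (\<delta> * sqrt (real m)) I) = \<delta> * (\<Sum>b<m. ?x a b (I b))"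
      by (simp add: scalar_prod_block_vec[OF _ mk] sum_distrib_left if_distrib mult_ac cong: if_cong)
  qed
qed

text \<open>Products and scaled unit vectors are put into the pool first, then filled up. For a
  single block the products are themselves unit vectors, so \<open>d \<le> K\<close> leaves enough
  room.\<close>

lemma hard_instance_product:
  assumes m: "1 \<le> m" and k: "4 \<le> k" and mk: "m * k \<le> d" and dK: "d \<le> K"
    and K: "m = 1 \<or> k ^ m + d \<le> K"
  shows "\<exists>A x. hard_instance d K m k A x"
proof -
  let ?c = "1 / sqrt (real m)"
  let ?E = "(\<lambda>j. ?c \<cdot>\<^sub>v unit_vec d j) ` {..<d} :: rvec set"
  let ?V = "block_vec d m k ?c ` (PiE {..<m} (\<lambda>_. {..<k}))"
  have c0: "?c > 0" using m by simp
  have d0: "0 < d" using m k mk by (cases d) auto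
  have fin: "finite (?V \<union> ?E)" by (simp add: finite_PiE)
  have cE: "card ?E \<le> d" using card_image_le[of "{..<d}"] by fastforce
  have cVE: "card (?V \<union> ?E) \<le> K"
  proof (cases "m = 1")
    case True
    have "?V \<subseteq> ?E"
    proof
      fix v assume "v \<in> ?V"
      then obtain I where I: "I \<in> PiE {..<m} (\<lambda>_. {..<k})" and v: "v = block_vec d m k ?c I" by auto
      have I0: "I 0 < k" using I True by auto
      have "v = ?c \<cdot>\<^sub>v unit_vec d (I 0)"
        using I0 mk unfolding v True block_vec_def by (intro eq_vecI) auto
      then show "v \<in> ?E" using I0 mk True by auto
    qed
    then show ?thesis using cE dK by (simp add: Un_absorb1)
  next
    case False
    have "card ?V \<le> k ^ m"
      using card_image_le[of "PiE {..<m} (\<lambda>_. {..<k})" "block_vec d m k ?c"] by (simp add: finite_PiE card_PiE)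
    then show ?thesis using cE K False card_Un_le[of ?V ?E] by linarith
  qed
  have VE: "?V \<union> ?E \<subseteq> block_pool d m k"
    by (intro Un_least image_subsetI block_vec_in_block_pool scaled_unit_in_block_pool m mk) auto
  have inf: "infinite (block_pool d m k)"
  proof (rule infinite_super[OF _ infinite_scaled_unit[OF d0 c0]])
    show "(\<lambda>r. r \<cdot>\<^sub>v unit_vec d 0) ` {0<..<?c} \<subseteq> block_pool d m k"
      using d0 by (auto intro!: scaled_unit_in_block_pool[OF m mk])
  qed
  obtain A where A: "?V \<union> ?E \<subseteq> A" "A \<subseteq> block_pool d m k" "finite A" "card A = K"
    by (rule fill_up[OF fin cVE VE inf])
  have car: "A \<subseteq> carrier_vec d" using A by (auto simp: block_pool_def)
  moreover have "spans d A"
    by (rule spans_scaled_units[OF car, of ?c]) (use c0 A in auto)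
  moreover have "\<forall>a\<in>A. l2_norm a \<le> 1" using A by (auto simp: block_pool_def)
  moreover have "block_features d m k A (\<lambda>a b i. if i < k then sqrt (real m) * vec_index a (b * k + i) else 0)"
    by (rule block_features_product[OF m k mk A(2)]) (use A in auto)
  ultimately have "hard_instance d K m k A (\<lambda>a b i. if i < k then sqrt (real m) * vec_index a (b * k + i) else 0)"
    using A m k by (simp add: hard_instance_def action_set_def)
  then show ?thesis by blast
qed

text \<open>The two arms are opposite unit vectors with features of opposite sign. These sum to 0,
  and their squares to at most 2, which accounts for the constant 2 in
  \<open>block_features\<close>.\<close>

lemma hard_instance_sign:
  assumes d: "1 \<le> d" and dK: "d + 1 \<le> K"
  shows "\<exists>A x. hard_instance d K 1 2 A x"
proof -
  let ?P = "{a \<in> carrier_vec d. l2_norm a \<le> 1} :: rvec set"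
  let ?e = "\<lambda>s::real. s \<cdot>\<^sub>v unit_vec d 0 :: rvec"
  let ?E = "(\<lambda>j. 1 \<cdot>\<^sub>v unit_vec d j) ` {..<d} :: rvec set"
  let ?C = "insert (?e (- 1)) ?E"
  let ?x = "\<lambda>(a :: rvec) (b::nat) (i::nat). if i = 0 then vec_index a 0 else if i = 1 then - vec_index a 0 else 0"
  have d0: "0 < d" using d by simp
  have "card ?E \<le> d" using card_image_le[of "{..<d}"] by fastforce
  then have cC: "card ?C \<le> K" using dK card_insert_le_m1[of "d + 1" ?E "?e (- 1)"] by simp
  have CP: "?C \<subseteq> ?P" using d0 by (auto simp: l2_norm_def)
  have inf: "infinite ?P"
    by (rule infinite_super[OF _ infinite_scaled_unit[OF d0, of 1]]) (use d0 in \<open>auto simp: l2_norm_scaled_unit\<close>)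
  have fin: "finite ?C" by simp
  obtain A where A: "?C \<subseteq> A" "A \<subseteq> ?P" "finite A" "card A = K"
    by (rule fill_up[OF fin cC CP inf])
  have car: "A \<subseteq> carrier_vec d" using A by auto
  have sp: "spans d A" by (rule spans_scaled_units[OF car, of 1]) (use A in auto)
  have a1: "\<bar>vec_index a 0\<bar> \<le> 1" if "a \<in> A" for a
  proof -
    have "(vec_index a 0)\<^sup>2 \<le> scalar_prod a a"
      using that car d0 unfolding scalar_prod_def power2_eq_square
      by (intro member_le_sum[of 0 _ "\<lambda>i. vec_index a i * vec_index a i"]) auto
    also have "\<dots> \<le> 1" using that A(2) by (auto simp: l2_norm_def)
    finally show ?thesis by (simp add: abs_square_le_1)
  qed
  have "block_features d 1 2 A ?x"
    unfolding block_features_def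
  proof (intro conjI ballI allI impI)
    fix a b assume a: "a \<in> A"
    show "?x a b 2 = 0" by simp
    show "\<bar>?x a b i\<bar> \<le> 1" for i using a1[OF a] by simp
    show "(\<Sum>i<2. ?x a b i) \<le> real 2 / 2" by (simp add: numeral_2_eq_2)
    have "(vec_index a 0)\<^sup>2 \<le> 1" using a1[OF a] by (simp add: abs_square_le_1)
    then show "(\<Sum>i<2. (?x a b i)\<^sup>2) \<le> 2" by (simp add: numeral_2_eq_2)
  next
    fix I :: "nat \<Rightarrow> nat" assume "I \<in> {..<1} \<rightarrow> {..<2}"
    then have "I 0 < 2" by (auto simp: Pi_iff)
    then have "I 0 = 0 \<or> I 0 = 1" by linarith
    moreover have "?e 1 \<in> A" "?e (- 1) \<in> A" using A(1) d0 by auto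
    ultimately show "\<exists>a\<in>A. \<forall>b<1. ?x a b (I b) = 1"
      using d0 by (intro bexI[of _ "?e (if I 0 = 0 then 1 else - 1)"]) auto
  next
    fix \<delta> :: real assume \<delta>: "0 < \<delta>" "real 1 * \<delta> \<le> 1"
    let ?s = "\<lambda>I :: nat \<Rightarrow> nat. if I 0 = 0 then \<delta> else if I 0 = 1 then - \<delta> else 0"
    show "\<exists>\<theta>. \<forall>I\<in>{..<1} \<rightarrow> {..2}. \<theta> I \<in> carrier_vec d \<and> l2_norm (\<theta> I) \<le> 1 \<and>
        (\<forall>a\<in>A. scalar_prod a (\<theta> I) = \<delta> * (\<Sum>b<1. ?x a b (I b)))"
    proof (intro exI[of _ "\<lambda>I. ?e (?s I)"] ballI conjI)
      fix I :: "nat \<Rightarrow> nat"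
      show "?e (?s I) \<in> carrier_vec d" by simp
      show "l2_norm (?e (?s I)) \<le> 1" using \<delta> by (simp add: l2_norm_scaled_unit[OF d0])
      fix a assume "a \<in> A"
      then have "a \<in> carrier_vec d" using car by auto
      then show "scalar_prod a (?e (?s I)) = \<delta> * (\<Sum>b<1. ?x a b (I b))"
        using d0 by simp
    qed
  qed
  then have "hard_instance d K 1 2 A ?x"
    using A car sp by (auto simp: hard_instance_def action_set_def)
  then show ?thesis by blast
qed

section \<open>Choice of the block sizes\<close>

lemma obtain_floor:
  fixes y :: real
  assumes "1 \<le> y"
  obtains m :: nat where "1 \<le> m" "real m \<le> y" "y / 2 \<le> real m"
proof
  let ?m = "nat \<lfloor>y\<rfloor>"
  have "1 \<le> \<lfloor>y\<rfloor>" using assms by simp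
  then show "1 \<le> ?m" "real ?m \<le> y" by (auto simp: le_nat_iff)
  have "1 \<le> real_of_int \<lfloor>y\<rfloor>" using \<open>1 \<le> \<lfloor>y\<rfloor>\<close> by simp
  then have "y / 2 \<le> real_of_int \<lfloor>y\<rfloor>" using real_of_int_floor_add_one_gt[of y] by linarith
  then show "y / 2 \<le> real ?m" using \<open>1 \<le> \<lfloor>y\<rfloor>\<close> by simp
qed

text \<open>Each summand is at most the cube root of \<open>K\<close>, hence at most
  \<open>K / 2\<close> as \<open>K\<close> is at least 8.\<close>

lemma two_cube_roots_le:
  fixes a b K :: real
  assumes "16 \<le> K" "ln a \<le> ln K / 3" "ln b \<le> ln K / 3" "0 < a" "0 < b"
  shows "a + b \<le> K"
proof -
  have r: "c \<le> K / 2" if "0 < c" "ln c \<le> ln K / 3" for c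
  proof -
    have "ln 8 = 3 * ln (2::real)" using ln_realpow[of "2::real" 3] by simp
    moreover have "ln 8 \<le> ln K" using assms(1) by (intro ln_mono) auto
    moreover have "0 \<le> ln (2::real)" by simp
    ultimately have "ln c \<le> ln K - ln 2" using that(2) by argo
    also have "\<dots> = ln (K / 2)" using assms(1) by (simp add: ln_div)
    finally show ?thesis using that(1) assms(1) by simp
  qed
  from r[of a] r[of b] assms show ?thesis by simp
qed

text \<open>With \<open>m\<close> blocks of size \<open>k \<le> q\<close>, the products of arms and the basis together number at most
  \<open>q ^ m + d \<le> 2 K powr (1 / 3) \<le> K\<close>.\<close>

lemma number_of_blocks:
  fixes d K :: nat and q :: real
  assumes d: "4 \<le> d" and K: "16 \<le> K" and dK: "3 * ln (real d) < ln (real K)" and q: "4 \<le> q" "q \<le> real d"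
  obtains m :: nat where "1 \<le> m" "4 * m \<le> d" "min (real d / 4) (ln (real K) / (3 * ln q)) / 2 \<le> real m"
    "\<And>k. 1 \<le> k \<Longrightarrow> real k \<le> q \<Longrightarrow> k ^ m + d \<le> K"
proof -
  let ?y = "min (real d / 4) (ln (real K) / (3 * ln q))"
  have lq: "0 < ln q" using q by simp
  have "ln q \<le> ln (real d)" using q by (intro ln_mono) auto
  then have "3 * ln q \<le> ln (real K)" using dK by linarith
  \<comment> \<open>At least one block fits, because \<open>d\<close> is at least 4 and
    \<open>q\<close> at most \<open>d\<close>, below the cube root of \<open>K\<close>.\<close>
  then have "1 \<le> ?y" using d lq by (simp add: field_simps)
  then obtain m :: nat where m: "1 \<le> m" "real m \<le> ?y" "?y / 2 \<le> real m" using obtain_floor by blast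
  have "real m * ln q \<le> ln (real K) / 3" using m(2) lq by (simp add: field_simps)
  have "k ^ m + d \<le> K" if k: "1 \<le> k" "real k \<le> q" for k
  proof -
    have "ln (real k) \<le> ln q" using k by (intro ln_mono) auto
    then have "real m * ln (real k) \<le> real m * ln q" by (intro mult_left_mono) auto
    then have "ln (real k ^ m) \<le> ln (real K) / 3"
      using \<open>real m * ln q \<le> ln (real K) / 3\<close> k by (simp add: ln_realpow)
    then have "real k ^ m + real d \<le> real K"
      using k d K dK by (intro two_cube_roots_le) auto
    then show ?thesis by (simp flip: of_nat_power of_nat_add)
  qed
  moreover have "4 * m \<le> d" using m(2) by simp
  ultimately show thesis using that m by blast
qed

section \<open>Hard instances for each of the two terms\<close>

definition budget :: "nat \<Rightarrow> nat \<Rightarrow> real" where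
  "budget d K = min (real d) (ln (real K))"

lemma ln_4_bounds: "1 \<le> ln (4::real)" "ln (4::real) \<le> 2"
proof -
  have "exp 1 \<le> (4::real)" using exp_le by linarith
  then have "ln (exp 1) \<le> ln (4::real)" by (subst ln_le_cancel_iff) auto
  then show "1 \<le> ln (4::real)" by simp
  show "ln (4::real) \<le> 2" using ln_realpow[of "2::real" 2] ln_le_minus_one[of "2::real"] by simp
qed

text \<open>The prior has entropy \<open>m * ln k\<close>, and blocks of constant size 4 make it
  proportional to \<open>budget d K\<close>. The 12 combines \<open>ln 4 \<le> 2\<close>, the cube
  root of \<open>K\<close> and the rounding of \<open>m\<close>.\<close>

lemma hard_instance_bits:
  assumes "1 \<le> d" "16 \<le> K" "d \<le> K"
  shows "\<exists>A m k x. hard_instance d K m k A x \<and> budget d K / 12 \<le> real m * ln (real k)"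
proof -
  consider "d < 4" | "4 \<le> d" "ln (real K) \<le> 3 * ln (real d)" | "4 \<le> d" "3 * ln (real d) < ln (real K)"
    by linarith
  then show ?thesis
  proof cases
    case 1
    then obtain A x where "hard_instance d K 1 2 A x" using hard_instance_sign[of d K] assms by auto
    moreover have "budget d K / 12 \<le> real 1 * ln (real 2)"
    proof -
      have "ln 4 = 2 * ln (2::real)" using ln_realpow[of "2::real" 2] by simp
      then show ?thesis using 1 ln_4_bounds by (simp add: budget_def min_def)
    qed
    ultimately show ?thesis by blast
  next
    case 2
    then obtain A x where "hard_instance d K 1 d A x"
      using hard_instance_product[of 1 d d K] assms by auto
    moreover have "budget d K / 12 \<le> real 1 * ln (real d)"
    proof -
      have "budget d K \<le> ln (real K)" "0 \<le> ln (real d)" using assms by (simp_all add: budget_def)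
      then show ?thesis using 2(2) by simp
    qed
    ultimately show ?thesis by blast
  next
    case 3
    obtain m where m: "1 \<le> m" "4 * m \<le> d" "min (real d / 4) (ln (real K) / (3 * ln 4)) / 2 \<le> real m"
      "\<And>k. 1 \<le> k \<Longrightarrow> real k \<le> 4 \<Longrightarrow> k ^ m + d \<le> K"
      by (rule number_of_blocks[OF 3(1) assms(2) 3(2), of 4]) (use 3 in auto)
    have "4 ^ m + d \<le> K" using m(4)[of 4] by simp
    then obtain A x where "hard_instance d K m 4 A x"
      using hard_instance_product[of m 4 d K] m assms by (auto simp: mult.commute)
    moreover have "budget d K / 12 \<le> real m * ln (real 4)"
    proof -
      have lK: "0 \<le> ln (real K)" using assms by simp
      have "ln (real K) / 6 \<le> ln (real K) / (3 * ln 4)"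
        using lK ln_4_bounds by (intro divide_left_mono) auto
      moreover have "budget d K / 6 \<le> real d / 4" "budget d K / 6 \<le> ln (real K) / 6"
        using lK by (auto simp: budget_def min_def)
      ultimately have "budget d K / 6 \<le> min (real d / 4) (ln (real K) / (3 * ln 4))" by simp
      then have "budget d K / 12 \<le> real m" using m(3) by argo
      also have "\<dots> \<le> real m * ln (real 4)" using mult_left_mono[OF ln_4_bounds(1), of "real m"] by simp
      finally show ?thesis .
    qed
    ultimately show ?thesis by blast
  qed
qed

text \<open>Here the logarithmic factor is lost. Blocks are as wide as possible, so that
  \<open>m * k\<close> is of order \<open>d\<close>; with up to \<open>d\<close> arms each, a set of
  size \<open>K\<close> has room for only about \<open>ln K / ln d\<close> of them.\<close>

lemma hard_instance_information:
  assumes "1 \<le> d" "16 \<le> K" "d \<le> K"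
  shows "\<exists>A m k x. hard_instance d K m k A x \<and>
    real d * budget d K / (12 * (1 + ln (real d))) \<le> (real m)\<^sup>2 * real k"
proof -
  have ld: "0 \<le> ln (real d)" using assms by simp
  have lK: "0 \<le> ln (real K)" using assms by simp
  have b0: "0 \<le> budget d K" using lK by (simp add: budget_def)
  consider "d < 4" | "4 \<le> d" "ln (real K) \<le> 3 * ln (real d)" | "4 \<le> d" "3 * ln (real d) < ln (real K)"
    by linarith
  then show ?thesis
  proof cases
    case 1
    then obtain A x where "hard_instance d K 1 2 A x" using hard_instance_sign[of d K] assms by auto
    moreover have "real d * budget d K / (12 * (1 + ln (real d))) \<le> (real 1)\<^sup>2 * real 2"
    proof -
      have "real d * budget d K \<le> 3 * 3"
        using 1 b0 by (intro mult_mono) (auto simp: budget_def)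
      also have "\<dots> \<le> 12 * (1 + ln (real d))" using ld by simp
      finally show ?thesis using ld by (simp add: divide_le_eq)
    qed
    ultimately show ?thesis by blast
  next
    case 2
    then obtain A x where "hard_instance d K 1 d A x"
      using hard_instance_product[of 1 d d K] assms by auto
    moreover have "real d * budget d K / (12 * (1 + ln (real d))) \<le> (real 1)\<^sup>2 * real d"
    proof -
      have "budget d K \<le> ln (real K)" by (simp add: budget_def)
      then have "budget d K \<le> 12 * (1 + ln (real d))" using 2(2) ld by argo
      then have "real d * budget d K \<le> real d * (12 * (1 + ln (real d)))" by (intro mult_left_mono) auto
      then show ?thesis using ld by (simp add: divide_le_eq)
    qed
    ultimately show ?thesis by blast
  next
    case 3
    obtain m where m: "1 \<le> m" "4 * m \<le> d" "min (real d / 4) (ln (real K) / (3 * ln (real d))) / 2 \<le> real m"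
      "\<And>k. 1 \<le> k \<Longrightarrow> real k \<le> real d \<Longrightarrow> k ^ m + d \<le> K"
      by (rule number_of_blocks[OF 3(1) assms(2) 3(2), of "real d"]) (use 3 in auto)
    define k where "k = d div m"
    have k4: "4 \<le> k" using m unfolding k_def by (simp add: less_eq_div_iff_mult_less_eq)
    have mk: "m * k \<le> d" by (simp add: k_def)
    have "k \<le> d" by (simp add: k_def)
    then obtain A x where "hard_instance d K m k A x"
      using hard_instance_product[OF m(1) k4 mk assms(3)] m(4)[of k] k4 by auto
    moreover have "real d * budget d K / (12 * (1 + ln (real d))) \<le> (real m)\<^sup>2 * real k"
    proof -
      \<comment> \<open>Rounding \<open>d div m\<close> down loses less than \<open>m\<close>
        coordinates, so at least half of \<open>d\<close> is covered.\<close>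
      have "d < m * k + m"
        using dividend_less_div_times[of m d] m(1) by (simp add: k_def mult.commute add.commute)
      also have "m * k + m \<le> 2 * (m * k)" using k4 by simp
      finally have dk: "real d / 2 \<le> real m * real k" by (simp flip: of_nat_mult)
      have lnd: "1 \<le> ln (real d)"
        by (rule order_trans[OF ln_4_bounds(1) ln_mono]) (use 3 in auto)
      have "budget d K / (6 * (1 + ln (real d))) \<le> real m"
      proof -
        have "budget d K / (3 * (1 + ln (real d))) \<le> real d / 4"
        proof -
          have "budget d K / (3 * (1 + ln (real d))) \<le> real d / (3 * (1 + ln (real d)))"
            using ld by (intro divide_right_mono) (auto simp: budget_def)
          also have "\<dots> \<le> real d / 4" using lnd by (intro divide_left_mono) auto
          finally show ?thesis .
        qed
        moreover have "budget d K / (3 * (1 + ln (real d))) \<le> ln (real K) / (3 * ln (real d))"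
          using lnd b0 lK by (intro frac_le) (auto simp: budget_def)
        ultimately have "budget d K / (3 * (1 + ln (real d))) / 2 \<le>
            min (real d / 4) (ln (real K) / (3 * ln (real d))) / 2"
          by (intro divide_right_mono min.boundedI) auto
        also have "\<dots> \<le> real m" by (rule m(3))
        also have "budget d K / (3 * (1 + ln (real d))) / 2 = budget d K / (6 * (1 + ln (real d)))"
          by (simp add: divide_divide_eq_left)
        finally show ?thesis .
      qed
      then have "budget d K / (6 * (1 + ln (real d))) * (real d / 2) \<le> real m * (real m * real k)"
        using dk b0 ld by (intro mult_mono) auto
      then show ?thesis by (simp add: power2_eq_square mult_ac)
    qed
    ultimately show ?thesis by blast
  qed
qed

section \<open>Combination of the two bounds\<close>

definition bits_term :: "nat \<Rightarrow> nat \<Rightarrow> nat \<Rightarrow> real" where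
  "bits_term d B K = real B * budget d K"

definition sqrt_term :: "nat \<Rightarrow> nat \<Rightarrow> nat \<Rightarrow> real" where
  "sqrt_term d T K = sqrt (real d * real T * budget d K)"

text \<open>The set is built for the larger term, which is at least half of the sum. Thus
  \<open>3456 = 6 * (12 * 24) * 2\<close> for the first term, and
  \<open>384 = 4 * (12 * 4) * 2\<close> for the second.\<close>

lemma hard_set_exists:
  assumes slo: "0 < \<sigma>lo" and adm: "admissible \<sigma>lo \<sigma>hi d T B K \<sigma>"
  shows "\<exists>A. action_set d A \<and> card A = K \<and> (\<forall>a\<in>A. l2_norm a \<le> 1) \<and>
    (\<forall>L. valid_learner T B A L \<longrightarrow> min (1 / 3456) (\<sigma>lo / 384) *
       min (real T) (bits_term d B K + sqrt_term d T K / (1 + ln (real d)))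
     \<le> worst_case_regret (gaussian \<sigma>) L d T B A)"
proof -
  let ?f = "bits_term d B K" and ?g = "sqrt_term d T K / (1 + ln (real d))"
  let ?c = "min (1 / 3456) (\<sigma>lo / 384)"
  have adm': "1 \<le> d" "1 \<le> T" "1 \<le> B" "16 \<le> K" "d \<le> K" "\<sigma>lo \<le> \<sigma>"
    using adm by (auto simp: admissible_def)
  have \<sigma>: "0 < \<sigma>" using slo adm' by linarith
  have ld: "0 \<le> ln (real d)" using adm' by simp
  have b0: "0 \<le> budget d K" using adm' by (simp add: budget_def)
  have f0: "0 \<le> ?f" and g0: "0 \<le> ?g" using b0 ld by (auto simp: bits_term_def sqrt_term_def)
  \<comment> \<open>Arithmetic shared by both cases: \<open>w\<close> is the larger term and
    \<open>z\<close> the quantity in the bound proved for the chosen set. Since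
    \<open>e \<le> 1\<close>, the factor \<open>e\<close> can be absorbed by \<open>T\<close> inside
    the minimum.\<close>
  have scale: "?c * min (real T) (?f + ?g) \<le> r"
    if h: "c' * min (real T) z \<le> r" "0 < c'" "?f + ?g \<le> 2 * w" "e * w \<le> z" "0 < e" "e \<le> 1" "?c \<le> c' * e / 2" "0 \<le> w"
    for c' z w e r :: real
  proof -
    have "?c * min (real T) (?f + ?g) \<le> c' * e / 2 * min (real T) (?f + ?g)"
      using h f0 g0 by (intro mult_right_mono) auto
    also have "\<dots> \<le> c' * e / 2 * min (2 * real T) (2 * w)"
      using h by (intro mult_left_mono) auto
    also have "\<dots> = c' * min (e * real T) (e * w)"
      using h by (simp add: min_mult_distrib_left)
    also have "\<dots> \<le> c' * min (real T) z"
      using h by (intro mult_left_mono min.mono) (auto simp: mult_left_le_one_le)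
    finally show ?thesis using h(1) by simp
  qed
  have bandit: "block_bandit d T B A L m k x" if "hard_instance d K m k A x" "valid_learner T B A L" for A L m k x
    using that adm' by unfold_locales (auto simp: hard_instance_def action_set_def)
  show ?thesis
  proof (cases "?g \<le> ?f")
    case True
    obtain A m k x where h: "hard_instance d K m k A x" "budget d K / 12 \<le> real m * ln (real k)"
      using hard_instance_bits[of d K] adm' by blast
    have "?c * min (real T) (?f + ?g) \<le> worst_case_regret (gaussian \<sigma>) L d T B A" if "valid_learner T B A L" for L
    proof -
      interpret block_bandit d T B A L m k x by (rule bandit[OF h(1) that])
      show ?thesis
      proof (rule scale)
        show "1 / 6 * min (real T) (real B * (real m * ln (real k) / 24)) \<le> worst_case_regret (gaussian \<sigma>) L d T B A"
          using worst_case_regret_ge_bits[OF prob_space_gaussian[OF \<sigma>] sets_gaussian] by simp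
        show "?f + ?g \<le> 2 * ?f" using True by simp
        have "real B * (budget d K / 12 / 24) \<le> real B * (real m * ln (real k) / 24)"
          using h(2) by (intro mult_left_mono divide_right_mono) auto
        then show "1 / 288 * ?f \<le> real B * (real m * ln (real k) / 24)" by (simp add: bits_term_def)
      qed (use f0 in auto)
    qed
    then show ?thesis using h(1) unfolding hard_instance_def by blast
  next
    case False
    obtain A m k x where h: "hard_instance d K m k A x"
      "real d * budget d K / (12 * (1 + ln (real d))) \<le> (real m)\<^sup>2 * real k"
      using hard_instance_information[of d K] adm' by blast
    have "?c * min (real T) (?f + ?g) \<le> worst_case_regret (gaussian \<sigma>) L d T B A" if "valid_learner T B A L" for L
    proof -
      interpret block_bandit d T B A L m k x by (rule bandit[OF h(1) that])
      \<comment> \<open>The cap at 1 ensures \<open>e \<le> 1\<close> in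
        \<open>scale\<close>.\<close>
      let ?s = "min 1 \<sigma>lo"
      let ?z = "\<sigma> / 12 * sqrt ((real m)\<^sup>2 * real k * real T)"
      show ?thesis
      proof (rule scale)
        show "1 / 4 * min (real T) ?z \<le> worst_case_regret (gaussian \<sigma>) L d T B A"
          using worst_case_regret_ge_sqrt[OF \<sigma>] by simp
        show "?f + ?g \<le> 2 * ?g" using False by simp
        \<comment> \<open>The instance has \<open>1 + ln d\<close> under the root; dividing outside
          the root is weaker because \<open>1 + ln d\<close> is at least 1. Replacing 12 by 16 gives
          a square.\<close>
        have "(?g / 4)\<^sup>2 = (sqrt_term d T K)\<^sup>2 / (16 * (1 + ln (real d))\<^sup>2)"
          by (simp only: power_divide divide_divide_eq_left) (simp add: mult.commute del: distrib_right_numeral distrib_left_numeral)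
        also have "(sqrt_term d T K)\<^sup>2 = real d * budget d K * real T"
          using b0 by (simp add: sqrt_term_def)
        also have "real d * budget d K * real T / (16 * (1 + ln (real d))\<^sup>2) \<le>
            real d * budget d K * real T / (12 * (1 + ln (real d)))"
        proof (rule divide_left_mono)
          have "12 * (1 + ln (real d)) * 1 \<le> 16 * (1 + ln (real d)) * (1 + ln (real d))"
            using ld by (intro mult_mono) auto
          then show "12 * (1 + ln (real d)) \<le> 16 * (1 + ln (real d))\<^sup>2"
            by (simp add: power2_eq_square mult_ac)
        qed (use b0 ld in auto)
        also have "\<dots> = real d * budget d K / (12 * (1 + ln (real d))) * real T" by simp
        also have "\<dots> \<le> (real m)\<^sup>2 * real k * real T" using h(2) by (intro mult_right_mono) auto
        finally have "?g / 4 \<le> sqrt ((real m)\<^sup>2 * real k * real T)" by (rule real_le_rsqrt)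
        moreover have "?s / 12 \<le> \<sigma> / 12" using adm' by simp
        ultimately have "?s / 12 * (?g / 4) \<le> ?z"
          using \<sigma> by (intro mult_mono divide_nonneg_nonneg[OF g0]) auto
        then show "?s / 48 * ?g \<le> ?z" by simp
        show "?c \<le> 1 / 4 * (?s / 48) / 2" by (simp add: min_def)
      qed (use g0 slo in auto)
    qed
    then show ?thesis using h(1) unfolding hard_instance_def by blast
  qed
qed

text \<open>Transfers the bound to terms of the same order: a loss by a factor
  \<open>e \<le> 1\<close> goes into the constant. The power of \<open>1 + ln d\<close> is
  1.\<close>

lemma regret_Omega_tildeI:
  assumes noise: "\<And>d T B K \<sigma> L. admissible \<sigma>lo \<sigma>hi d T B K \<sigma> \<Longrightarrow> valid_learner T B (hard d T B K \<sigma>) L \<Longrightarrow>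
      c * min (real T) (bits_term d B K + sqrt_term d T K / (1 + ln (real d)))
        \<le> worst_case_regret (noise \<sigma>) L d T B (hard d T B K \<sigma>)"
    and c: "0 < c" and e: "0 < e" "e \<le> 1"
    and f: "\<And>d T B K \<sigma>. admissible \<sigma>lo \<sigma>hi d T B K \<sigma> \<Longrightarrow> P d K \<Longrightarrow> e * f d T B K \<le> bits_term d B K"
    and g: "\<And>d T B K \<sigma>. admissible \<sigma>lo \<sigma>hi d T B K \<sigma> \<Longrightarrow> P d K \<Longrightarrow> e * g d T B K \<le> sqrt_term d T K"
  shows "regret_Omega_tilde noise hard \<sigma>lo \<sigma>hi P f g"
  unfolding regret_Omega_tilde_def
proof (intro exI[of _ "c * e"] exI[of _ "1::nat"] conjI allI impI)
  show "0 < c * e" using c e by simp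
  fix d T B K \<sigma> L
  assume adm: "admissible \<sigma>lo \<sigma>hi d T B K \<sigma>" and P: "P d K"
    and L: "valid_learner T B (hard d T B K \<sigma>) L"
  have ld: "0 \<le> ln (real d)" using adm by (simp add: admissible_def)
  have "c * e * min (real T) (f d T B K + g d T B K / (1 + ln (real d)) ^ 1) =
      c * min (e * real T) (e * f d T B K + e * g d T B K / (1 + ln (real d)))"
    using c e by (simp add: min_mult_distrib_left algebra_simps)
  also have "\<dots> \<le> c * min (real T) (bits_term d B K + sqrt_term d T K / (1 + ln (real d)))"
    using c e ld f[OF adm P] g[OF adm P]
    by (intro mult_left_mono min.mono add_mono divide_right_mono) (auto simp: mult_left_le_one_le)
  also have "\<dots> \<le> worst_case_regret (noise \<sigma>) L d T B (hard d T B K \<sigma>)"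
    by (rule noise[OF adm L])
  finally show "c * e * min (real T) (f d T B K + g d T B K / (1 + ln (real d)) ^ 1)
    \<le> worst_case_regret (noise \<sigma>) L d T B (hard d T B K \<sigma>)" .
qed

text \<open>In the second claim \<open>e\<close> may be weakened to its square root, since
  \<open>e \<le> 1\<close>, and then moved under the root.\<close>

lemma budget_le_imp:
  assumes "0 < e" "e \<le> 1" "e * z \<le> budget d K" "0 \<le> z"
  shows "e * (real B * z) \<le> bits_term d B K" "e * sqrt (real d * real T * z) \<le> sqrt_term d T K"
proof -
  show "e * (real B * z) \<le> bits_term d B K"
    using mult_left_mono[OF assms(3), of "real B"] by (simp add: bits_term_def mult_ac)
  have "e * sqrt (real d * real T * z) \<le> sqrt e * sqrt (real d * real T * z)"
  proof (rule mult_right_mono)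
    show "e \<le> sqrt e" using assms(1,2) by (intro real_le_rsqrt) (simp add: power2_eq_square mult_left_le)
  qed (use assms in auto)
  also have "\<dots> = sqrt (real d * real T * (e * z))" by (simp add: mult_ac flip: real_sqrt_mult)
  also have "\<dots> \<le> sqrt_term d T K"
    unfolding sqrt_term_def using assms(3) by (intro real_sqrt_le_mono mult_left_mono) auto
  finally show "e * sqrt (real d * real T * z) \<le> sqrt_term d T K" .
qed

theorem corollary1:
  shows "\<exists>noise :: real \<Rightarrow> real measure. (\<forall>\<sigma>>0. noise_law \<sigma> (noise \<sigma>)) \<and>
    (\<forall>\<sigma>lo \<sigma>hi. 0 < \<sigma>lo \<and> \<sigma>lo \<le> \<sigma>hi \<longrightarrow>
      (\<exists>hard :: nat \<Rightarrow> nat \<Rightarrow> nat \<Rightarrow> nat \<Rightarrow> real \<Rightarrow> rvec set.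
        (\<forall>d T B K \<sigma>. admissible \<sigma>lo \<sigma>hi d T B K \<sigma> \<longrightarrow>
           action_set d (hard d T B K \<sigma>) \<and> card (hard d T B K \<sigma>) = K \<and>
           (\<forall>a \<in> hard d T B K \<sigma>. l2_norm a \<le> 1)) \<and>
        regret_Omega_tilde noise hard \<sigma>lo \<sigma>hi (\<lambda>d K. True)
          (\<lambda>d T B K. real B * min (real d) (ln (real K)))
          (\<lambda>d T B K. sqrt (real d * real T * min (real d) (ln (real K)))) \<and>
        (\<forall>\<kappa>>0. regret_Omega_tilde noise hard \<sigma>lo \<sigma>hi (\<lambda>d K. exp (\<kappa> * real d) \<le> real K)
          (\<lambda>d T B K. real d * real B)
          (\<lambda>d T B K. real d * sqrt (real T))) \<and>
        (\<forall>\<kappa>>0. regret_Omega_tilde noise hard \<sigma>lo \<sigma>hi (\<lambda>d K. real K \<le> exp (\<kappa> * real d))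
          (\<lambda>d T B K. real B * ln (real K))
          (\<lambda>d T B K. sqrt (real d * real T * ln (real K))))))"
proof (intro exI[of _ gaussian] conjI allI impI)
  fix \<sigma>lo \<sigma>hi :: real
  assume "0 < \<sigma>lo \<and> \<sigma>lo \<le> \<sigma>hi"
  then have slo: "0 < \<sigma>lo" by simp
  define c where "c = min (1 / 3456) (\<sigma>lo / 384)"
  have c: "0 < c" using slo by (simp add: c_def)
  \<comment> \<open>Choice turns the sets into a function of the parameters; this one function
    serves all three regimes.\<close>
  obtain hard where hard: "action_set d (hard d T B K \<sigma>)" "card (hard d T B K \<sigma>) = K"
      "\<forall>a\<in>hard d T B K \<sigma>. l2_norm a \<le> 1"
      "valid_learner T B (hard d T B K \<sigma>) L \<Longrightarrow>
       c * min (real T) (bits_term d B K + sqrt_term d T K / (1 + ln (real d)))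
        \<le> worst_case_regret (gaussian \<sigma>) L d T B (hard d T B K \<sigma>)"
    if "admissible \<sigma>lo \<sigma>hi d T B K \<sigma>" for d T B K \<sigma> L
    unfolding c_def using hard_set_exists[OF slo, of \<sigma>hi] by metis
  note Omega = regret_Omega_tildeI[of \<sigma>lo \<sigma>hi hard c gaussian, OF hard(4) c]
  show "\<exists>hard :: nat \<Rightarrow> nat \<Rightarrow> nat \<Rightarrow> nat \<Rightarrow> real \<Rightarrow> rvec set.
        (\<forall>d T B K \<sigma>. admissible \<sigma>lo \<sigma>hi d T B K \<sigma> \<longrightarrow>
           action_set d (hard d T B K \<sigma>) \<and> card (hard d T B K \<sigma>) = K \<and>
           (\<forall>a \<in> hard d T B K \<sigma>. l2_norm a \<le> 1)) \<and>
        regret_Omega_tilde gaussian hard \<sigma>lo \<sigma>hi (\<lambda>d K. True)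
          (\<lambda>d T B K. real B * min (real d) (ln (real K)))
          (\<lambda>d T B K. sqrt (real d * real T * min (real d) (ln (real K)))) \<and>
        (\<forall>\<kappa>>0. regret_Omega_tilde gaussian hard \<sigma>lo \<sigma>hi (\<lambda>d K. exp (\<kappa> * real d) \<le> real K)
          (\<lambda>d T B K. real d * real B)
          (\<lambda>d T B K. real d * sqrt (real T))) \<and>
        (\<forall>\<kappa>>0. regret_Omega_tilde gaussian hard \<sigma>lo \<sigma>hi (\<lambda>d K. real K \<le> exp (\<kappa> * real d))
          (\<lambda>d T B K. real B * ln (real K))
          (\<lambda>d T B K. sqrt (real d * real T * ln (real K))))"
  proof (intro exI[of _ hard] conjI allI impI)
    show "regret_Omega_tilde gaussian hard \<sigma>lo \<sigma>hi (\<lambda>d K. True)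
          (\<lambda>d T B K. real B * min (real d) (ln (real K)))
          (\<lambda>d T B K. sqrt (real d * real T * min (real d) (ln (real K))))"
      by (rule Omega[where e = 1]) (auto simp: bits_term_def sqrt_term_def budget_def)
  next
    fix \<kappa> :: real assume \<kappa>: "0 < \<kappa>"
    \<comment> \<open>For exponentially many actions \<open>budget d K\<close> is \<open>d\<close>
      up to a constant.\<close>
    have b: "min 1 \<kappa> * real d \<le> budget d K"
      if "admissible \<sigma>lo \<sigma>hi d T B K \<sigma>" "exp (\<kappa> * real d) \<le> real K" for d T B K \<sigma>
    proof -
      have "\<kappa> * real d \<le> ln (real K)"
        using that by (subst ln_ge_iff) (auto simp: admissible_def)
      moreover have "min 1 \<kappa> * real d \<le> 1 * real d" "min 1 \<kappa> * real d \<le> \<kappa> * real d"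
        by (intro mult_right_mono; simp)+
      ultimately show ?thesis unfolding budget_def by simp
    qed
    have eq: "real d * sqrt (real T) = sqrt (real d * real T * real d)" for d T
      by (simp add: real_sqrt_mult)
    show "regret_Omega_tilde gaussian hard \<sigma>lo \<sigma>hi (\<lambda>d K. exp (\<kappa> * real d) \<le> real K)
          (\<lambda>d T B K. real d * real B) (\<lambda>d T B K. real d * sqrt (real T))"
    proof (rule Omega[where e = "min 1 \<kappa>"])
      fix d T B K \<sigma>
      assume "admissible \<sigma>lo \<sigma>hi d T B K \<sigma>" "exp (\<kappa> * real d) \<le> real K"
      from budget_le_imp[OF _ _ b[OF this]] \<kappa>
      show "min 1 \<kappa> * (real d * real B) \<le> bits_term d B K"
        "min 1 \<kappa> * (real d * sqrt (real T)) \<le> sqrt_term d T K"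
        unfolding eq by (simp_all add: mult.commute[of "real d" "real B"])
    qed (use \<kappa> in auto)
  next
    fix \<kappa> :: real assume \<kappa>: "0 < \<kappa>"
    \<comment> \<open>For at most exponentially many actions \<open>budget d K\<close> is
      \<open>ln K\<close> up to a constant.\<close>
    have b: "min 1 (1 / \<kappa>) * ln (real K) \<le> budget d K" and lK: "0 \<le> ln (real K)"
      if "admissible \<sigma>lo \<sigma>hi d T B K \<sigma>" "real K \<le> exp (\<kappa> * real d)" for d T B K \<sigma>
    proof -
      show lK: "0 \<le> ln (real K)" using that by (simp add: admissible_def)
      have K0: "0 < real K" using that by (simp add: admissible_def)
      have "ln (real K) \<le> ln (exp (\<kappa> * real d))" using that K0 by (intro ln_mono) auto
      then have "1 / \<kappa> * ln (real K) \<le> real d" using \<kappa> by (simp add: field_simps)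
      moreover have "min 1 (1 / \<kappa>) * ln (real K) \<le> 1 * ln (real K)"
        "min 1 (1 / \<kappa>) * ln (real K) \<le> 1 / \<kappa> * ln (real K)"
        using lK by (intro mult_right_mono; simp)+
      ultimately show "min 1 (1 / \<kappa>) * ln (real K) \<le> budget d K" unfolding budget_def by simp
    qed
    show "regret_Omega_tilde gaussian hard \<sigma>lo \<sigma>hi (\<lambda>d K. real K \<le> exp (\<kappa> * real d))
          (\<lambda>d T B K. real B * ln (real K)) (\<lambda>d T B K. sqrt (real d * real T * ln (real K)))"
      by (rule Omega[where e = "min 1 (1 / \<kappa>)"]) (use \<kappa> in \<open>auto intro!: budget_le_imp b lK\<close>)
  qed (use hard in auto)
qed (rule noise_law_gaussian)

end
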